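(* (Composition-Diamond lemma for Leibniz superalgebras) Let $\mathrm{Lb}_s(X)$ be the free Leibniz superalgebra over a field $k$ generated by a well-ordered set $X=X_0\cup X_1$, with linear basis $\mathrm{NF}(X)$, let $<$ be a deg-length-lex order on $\mathrm{NF}(X)$, let $S\subseteq \mathrm{Lb}_s(X)$ be a nonempty monic homogeneous set and let $\mathrm{Id}(S)$ be the graded ideal of $\mathrm{Lb}_s(X)$ generated by $S$. Then the following statements are equivalent. (i) The set $S$ is a Gröbner–Shirshov basis in $\mathrm{Lb}_s(X)$. (ii) If $0\neq f\in \mathrm{Id}(S)$, then $\overline{f}=\overline{h_s}$ for some normal $S$-polynomial $h_s$. (iii) The set $\mathrm{Irr}(S)=\{\tau\in \mathrm{NF}(X)\mid \tau\neq \overline{h_s}\text{ for any normal }S\text{-polynomial }h_s\}$ forms a linear basis of the Leibniz superalgebra $\mathrm{Lb}_s(X\mid S):=\mathrm{Lb}_s(X)/\mathrm{Id}(S)$ (i.e. the images of its elements do).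
   Context: Superalgebras. $k$ is a field. A superalgebra is a $k$-vector space $\mathcal A=\mathcal A_0\oplus\mathcal A_1$ with a bilinear product $(xy)$ such that $(\mathcal A_i\mathcal A_j)\subseteq\mathcal A_{i+j}$ (indices in $\mathbb Z_2$); elements of $\mathcal A_0\cup\mathcal A_1$ are homogeneous, with parity $|x|=i$ for $x\in\mathcal A_i$. It is a Leibniz superalgebra if $(x(yz))=((xy)z)-(-1)^{|z||y|}((xz)y)$ for all homogeneous $x,y,z$. Homomorphisms are parity-preserving linear multiplicative maps. Ideals are two-sided; an ideal $I$ is graded if $I=(I\cap\mathcal A_0)\oplus(I\cap\mathcal A_1)$. Free Leibniz superalgebra. $X=X_0\cup X_1$ (disjoint) is a nonempty well-ordered set, elements of $X_i$ having parity $i$; $\mathrm{Lb}_s(X)$ is the free Leibniz superalgebra over $k$ on $X$. Left-normed bracketing: $[f_1\cdots f_n]_L:=((\cdots((f_1f_2)f_3)\cdots)f_n)$, $[f_1]_L=f_1$. The set $\mathrm{NF}(X)=\{[a_1\cdots a_n]_L\mid a_i\in X,\ n\ge 1\}$ is a linear basis of $\mathrm{Lb}_s(X)$ (different words give different basis elements). For $\mu=[a_1\cdots a_n]_L$: length $\ell(\mu)=n$, parity $|\mu|=\sum|a_i|$ mod 2. Order. Let $\deg:X\to\mathbb Z_{>0}$ be a map, $\deg([a_1\cdots a_n]_L)=\sum\deg(a_i)$, $\mathrm{wt}(\mu)=(\deg(\mu),\ell(\mu),a_1,\dots,a_n)$. The deg-length-lex order (a well order) on $\mathrm{NF}(X)$: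 $\mu<\nu$ iff $\mathrm{wt}(\mu)<\mathrm{wt}(\nu)$ lexicographically. For $0\ne f\in\mathrm{Lb}_s(X)$, $\overline f$ is the largest element of $\mathrm{NF}(X)$ occurring in $f$ with nonzero coefficient (leading monomial); $f$ is monic if the coefficient of $\overline f$ is $1$. $f$ is homogeneous if all its monomials have the same parity. A set is monic (homogeneous) if all its elements are. Normal $S$-polynomials. For a monic homogeneous set $S$, $s\in S$, $a_1,\dots,a_m\in X$, $m\ge0$: (1) $[sa_1\cdots a_m]_L$ is a normal $S$-polynomial; (2) $[a_1\cdots a_t s a_{t+1}\cdots a_m]_L$ is a normal $S$-polynomial if $\ell(\overline s)=1$ and $1\le t\le m$. A normal $S$-polynomial built from $s$ is denoted $h_s$. Compositions. For $\mu\in\mathrm{NF}(X)$ and $n\in\mathbb Z_{>0}$, $h$ is trivial modulo $(S,\mu)$ (resp. $(S,n)$) if $h$ is a linear combination of normal $S$-polynomials whose leading monomials are $<\mu$ (resp. whose leading monomials have degree $\le n$). Inclusion composition: for $f\neq g$ in $S$ with $\overline f=\overline{h_g}$ for some normal $S$-polynomial $h_g$, $(f,g)_{\overline f}=f-h_g$. Left multiplication composition: for $f\in S$, $\mu\in\mathrm{NF}(X)$ with $\ell(\overline f)>1$ and $(\mu f)\ne0$, the element $(\mu f)$. $S$ is a Gröbner–Shirshov basis in $\mathrm{Lb}_s(X)$ if every left multiplication composition $(\mu f)$ is trivial modulo $(S,\deg(\mu)+\deg(\overline f))$ and every inclusion composition $(f,g)_{\overline f}$ is trivial modulo $(S,\overline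 f)$. *)

theory Defs
  imports HOL.Vector_Spaces "HOL-Library.Poly_Mapping" "HOL-Library.Z2"
begin

section \<open>Superalgebras\<close>

text \<open>The two-element field \<^typ>\<open>bit\<close> serves as the index set of the grading.\<close>

definition ssign :: "bit \<Rightarrow> 'k::field"
  where "ssign i = (if i = 0 then 1 else - 1)"

locale superalgebra = vector_space scale
  for scale :: "'k::field \<Rightarrow> 'a::ab_group_add \<Rightarrow> 'a" +
  fixes mult :: "'a \<Rightarrow> 'a \<Rightarrow> 'a"
    and grade :: "bit \<Rightarrow> 'a set"
  assumes mult_add_left: "mult (x + y) z = mult x z + mult y z"
    and mult_add_right: "mult x (y + z) = mult x y + mult x z"
    and mult_scale_left: "mult (scale c x) y = scale c (mult x y)"
    and mult_scale_right: "mult x (scale c y) = scale c (mult x y)"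
    and subspace_grade: "subspace (grade i)"
    and grade_decomp: "\<exists>y\<in>grade 0. \<exists>z\<in>grade 1. x = y + z"
    and grade_disjoint: "grade 0 \<inter> grade 1 = {0}"
    and mult_grade: "x \<in> grade i \<Longrightarrow> y \<in> grade j \<Longrightarrow> mult x y \<in> grade (i + j)"
begin

definition is_ideal :: "'a set \<Rightarrow> bool"
  where "is_ideal I \<longleftrightarrow> subspace I \<and> (\<forall>x\<in>I. \<forall>a. mult a x \<in> I \<and> mult x a \<in> I)"

definition graded_ideal :: "'a set \<Rightarrow> bool"
  where "graded_ideal I \<longleftrightarrow> is_ideal I \<and> (\<forall>x\<in>I. \<exists>y\<in>I \<inter> grade 0. \<exists>z\<in>I \<inter> grade 1. x = y + z)"

definition gen_ideal :: "'a set \<Rightarrow> 'a set"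
  where "gen_ideal S = graded_ideal hull S"

lemma grade_add: "x \<in> grade i \<Longrightarrow> y \<in> grade i \<Longrightarrow> x + y \<in> grade i"
  using subspace_grade subspace_add by blast

lemma grade_diff: "x \<in> grade i \<Longrightarrow> y \<in> grade i \<Longrightarrow> x - y \<in> grade i"
  using subspace_grade subspace_diff by blast

lemma grade_scale: "x \<in> grade i \<Longrightarrow> scale c x \<in> grade i"
  using subspace_grade subspace_scale by blast

lemma grade_zero: "0 \<in> grade i"
  using subspace_grade subspace_0 by blast

lemma grade_unique:
  assumes "y \<in> grade 0" "z \<in> grade 1" "y' \<in> grade 0" "z' \<in> grade 1" "y + z = y' + z'"
  shows "y = y'" "z = z'"
proof -
  have e: "y - y' = z' - z"
    using assms(5) by (simp add: algebra_simps)
  have "y - y' \<in> grade 0" "z' - z \<in> grade 1"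
    using assms grade_diff by auto
  then have "y - y' \<in> grade 0 \<inter> grade 1"
    using e by simp
  then have "y - y' = 0"
    using grade_disjoint by blast
  with e show "y = y'" "z = z'" by auto
qed

lemma mult_zero_left: "mult 0 y = 0"
  using mult_scale_left[of 0 0 y] by simp

lemma mult_zero_right: "mult x 0 = 0"
  using mult_scale_right[of x 0 0] by simp

lemma mult_diff_left: "mult (x - y) z = mult x z - mult y z"
  using mult_add_left[of "x - y" y z] by simp

lemma mult_diff_right: "mult x (y - z) = mult x y - mult x z"
  using mult_add_right[of x "y - z" z] by simp

lemma graded_ideal_Inter:
  assumes "\<forall>I\<in>T. graded_ideal I"
  shows "graded_ideal (\<Inter>T)"
proof (cases "T = {}")
  case True
  then show ?thesis
    using grade_decomp by (auto simp: graded_ideal_def is_ideal_def)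
next
  case False
  have sub: "subspace (\<Inter>T)"
    using assms by (auto simp: graded_ideal_def is_ideal_def subspace_def)
  have "\<exists>y\<in>\<Inter>T \<inter> grade 0. \<exists>z\<in>\<Inter>T \<inter> grade 1. x = y + z" if x: "x \<in> \<Inter>T" for x
  proof -
    obtain y z where yz: "y \<in> grade 0" "z \<in> grade 1" "x = y + z"
      using grade_decomp by blast
    have "y \<in> I \<and> z \<in> I" if "I \<in> T" for I
    proof -
      have "\<exists>y\<in>I \<inter> grade 0. \<exists>z\<in>I \<inter> grade 1. x = y + z"
        using assms that x unfolding graded_ideal_def by blast
      then obtain y' z' where "y' \<in> I \<inter> grade 0" "z' \<in> I \<inter> grade 1" "x = y' + z'"
        by blast
      then show ?thesis
        using grade_unique[of y z y' z'] yz by auto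
    qed
    then show ?thesis using yz by blast
  qed
  then show ?thesis
    using sub assms unfolding graded_ideal_def is_ideal_def by blast
qed

lemma graded_ideal_gen_ideal: "graded_ideal (gen_ideal S)"
  unfolding gen_ideal_def by (rule hull_in) (use graded_ideal_Inter in blast)

lemma gen_ideal_superset: "S \<subseteq> gen_ideal S"
  unfolding gen_ideal_def by (rule hull_subset)

lemma gen_ideal_minimal: "S \<subseteq> I \<Longrightarrow> graded_ideal I \<Longrightarrow> gen_ideal S \<subseteq> I"
  unfolding gen_ideal_def by (rule hull_minimal)

end

locale leibniz_superalgebra = superalgebra +
  assumes leibniz: "x \<in> grade i \<Longrightarrow> y \<in> grade j \<Longrightarrow> z \<in> grade l \<Longrightarrow>
    mult x (mult y z) = mult (mult x y) z - scale (ssign (l * j)) (mult (mult x z) y)"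

definition superalgebra_hom ::
  "('k::field \<Rightarrow> 'a::ab_group_add \<Rightarrow> 'a) \<Rightarrow> ('a \<Rightarrow> 'a \<Rightarrow> 'a) \<Rightarrow> (bit \<Rightarrow> 'a set) \<Rightarrow>
   ('k \<Rightarrow> 'b::ab_group_add \<Rightarrow> 'b) \<Rightarrow> ('b \<Rightarrow> 'b \<Rightarrow> 'b) \<Rightarrow> (bit \<Rightarrow> 'b set) \<Rightarrow> ('a \<Rightarrow> 'b) \<Rightarrow> bool"
  where "superalgebra_hom scale mult grade scale' mult' grade' h \<longleftrightarrow>
    Vector_Spaces.linear scale scale' h \<and> (\<forall>x y. h (mult x y) = mult' (h x) (h y)) \<and>
    (\<forall>i. h ` grade i \<subseteq> grade' i)"

section \<open>The free nonassociative superalgebra\<close>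

text \<open>A set of generators \<open>X = X\<^sub>0 \<union> X\<^sub>1\<close> is a type with a parity function;
  \<open>X\<^sub>i\<close> is the set of generators of parity \<open>i\<close>.\<close>

class super_set =
  fixes parity :: "'a \<Rightarrow> bit"

datatype 'x magma = Gen 'x | Node "'x magma" "'x magma"

primrec magma_parity :: "'x::super_set magma \<Rightarrow> bit"
  where
    "magma_parity (Gen x) = parity x"
  | "magma_parity (Node a b) = magma_parity a + magma_parity b"

type_synonym ('x, 'k) nonassoc = "'x magma \<Rightarrow>\<^sub>0 'k"

lift_definition fscale :: "'k::field \<Rightarrow> ('x, 'k) nonassoc \<Rightarrow> ('x, 'k) nonassoc"
  is "\<lambda>c f m. c * f m"
  by simp

text \<open>Bilinear extension of the magma operation. Every element of the free magma that is not
  a generator factors uniquely, so each coefficient of a product is a single product.\<close>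

lift_definition fmult :: "('x, 'k::field) nonassoc \<Rightarrow> ('x, 'k) nonassoc \<Rightarrow> ('x, 'k) nonassoc"
  is "\<lambda>f g m. case m of Gen x \<Rightarrow> 0 | Node a b \<Rightarrow> f a * g b"
proof -
  fix f g :: "'x magma \<Rightarrow> 'k"
  assume "finite {x. f x \<noteq> 0}" "finite {x. g x \<noteq> 0}"
  then have "finite ((\<lambda>(a, b). Node a b) ` ({x. f x \<noteq> 0} \<times> {x. g x \<noteq> 0}))"
    by blast
  moreover have "{m. (case m of Gen x \<Rightarrow> 0 | Node a b \<Rightarrow> f a * g b) \<noteq> 0}
    \<subseteq> (\<lambda>(a, b). Node a b) ` ({x. f x \<noteq> 0} \<times> {x. g x \<noteq> 0})"
    by (auto split: magma.splits simp: image_iff) (metis magma.exhaust)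
  ultimately show "finite {m. (case m of Gen x \<Rightarrow> 0 | Node a b \<Rightarrow> f a * g b) \<noteq> 0}"
    by (rule finite_subset[rotated])
qed

definition fgrade :: "bit \<Rightarrow> ('x::super_set, 'k::field) nonassoc set"
  where "fgrade i = {f. \<forall>m. Poly_Mapping.lookup f m \<noteq> 0 \<longrightarrow> magma_parity m = i}"

lemma lookup_fscale [simp]: "Poly_Mapping.lookup (fscale c f) m = c * Poly_Mapping.lookup f m"
  by transfer simp

lemma lookup_fmult:
  "Poly_Mapping.lookup (fmult f g) m = (case m of Gen x \<Rightarrow> 0 | Node a b \<Rightarrow> Poly_Mapping.lookup f a * Poly_Mapping.lookup g b)"
  by transfer simp

lemma fmult_single:
  "fmult (Poly_Mapping.single a 1) (Poly_Mapping.single b 1) = Poly_Mapping.single (Node a b) 1"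
  by (rule poly_mapping_eqI) (auto simp: lookup_fmult lookup_single when_def split: magma.split)

lemma vector_space_fscale: "vector_space fscale"
  by unfold_locales (auto intro!: poly_mapping_eqI simp: lookup_add algebra_simps)

lemma fgrade_decomp:
  fixes f :: "('x::super_set, 'k::field) nonassoc"
  shows "\<exists>y\<in>fgrade 0. \<exists>z\<in>fgrade 1. f = y + z"
proof -
  define part :: "bit \<Rightarrow> ('x, 'k) nonassoc" where
    "part i = Abs_poly_mapping (\<lambda>m. if magma_parity m = i then Poly_Mapping.lookup f m else 0)" for i
  have fin: "finite {m. (if magma_parity m = i then Poly_Mapping.lookup f m else 0) \<noteq> 0}" for i
    by (rule finite_subset[OF _ finite_lookup[of f]]) auto
  have lk: "Poly_Mapping.lookup (part i) = (\<lambda>m. if magma_parity m = i then Poly_Mapping.lookup f m else 0)" for i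
    unfolding part_def by (rule lookup_Abs_poly_mapping[OF fin])
  have "part i \<in> fgrade i" for i
    by (auto simp: fgrade_def lk)
  moreover have "f = part 0 + part 1"
  proof (rule poly_mapping_eqI)
    fix m
    show "Poly_Mapping.lookup f m = Poly_Mapping.lookup (part 0 + part 1) m"
      by (cases "magma_parity m") (auto simp: lookup_add lk)
  qed
  ultimately show ?thesis by blast
qed

lemma superalgebra_nonassoc:
  "superalgebra (fscale :: 'k::field \<Rightarrow> ('x::super_set, 'k) nonassoc \<Rightarrow> _) fmult fgrade"
proof (intro superalgebra.intro superalgebra_axioms.intro vector_space_fscale fgrade_decomp)
  interpret vector_space "fscale :: 'k \<Rightarrow> ('x, 'k) nonassoc \<Rightarrow> _" by (rule vector_space_fscale)
  show "subspace (fgrade i)" for i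
  proof (rule subspaceI)
    fix x y :: "('x, 'k) nonassoc" and c :: 'k
    assume "x \<in> fgrade i"
    then show "fscale c x \<in> fgrade i" by (auto simp: fgrade_def)
    assume "y \<in> fgrade i"
    with \<open>x \<in> fgrade i\<close> show "x + y \<in> fgrade i"
      by (auto simp: fgrade_def lookup_add) (metis add.left_neutral)
  qed (auto simp: fgrade_def)
  show "fgrade 0 \<inter> fgrade 1 = ({0} :: ('x, 'k) nonassoc set)"
  proof -
    have "f = 0" if "f \<in> fgrade 0" "f \<in> fgrade 1" for f :: "('x, 'k) nonassoc"
      by (rule poly_mapping_eqI) (use that in \<open>auto simp: fgrade_def\<close>)
    then show ?thesis by (auto simp: fgrade_def)
  qed
  show "fmult x y \<in> fgrade (i + j)" if "x \<in> fgrade i" "y \<in> fgrade j"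
    for x y :: "('x, 'k) nonassoc" and i j
    using that by (auto simp: fgrade_def lookup_fmult split: magma.splits)
qed (auto intro!: poly_mapping_eqI simp: lookup_add lookup_fmult algebra_simps split: magma.splits)

global_interpretation nonassoc: superalgebra fscale fmult fgrade
  by (rule superalgebra_nonassoc)

section \<open>The free Leibniz superalgebra\<close>

definition leibniz_elements :: "('x::super_set, 'k::field) nonassoc set"
  where "leibniz_elements =
    {fmult x (fmult y z) - (fmult (fmult x y) z - fscale (ssign (l * j)) (fmult (fmult x z) y))
      | x y z i j l. x \<in> fgrade i \<and> y \<in> fgrade j \<and> z \<in> fgrade l}"

definition leibniz_rel :: "('x::super_set, 'k::field) nonassoc \<Rightarrow> ('x, 'k) nonassoc \<Rightarrow> bool"
  where "leibniz_rel f g \<longleftrightarrow> f - g \<in> nonassoc.gen_ideal leibniz_elements"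

lemma leibniz_ideal:
  "nonassoc.subspace (nonassoc.gen_ideal leibniz_elements)"
  "f \<in> nonassoc.gen_ideal leibniz_elements \<Longrightarrow> fmult g f \<in> nonassoc.gen_ideal leibniz_elements"
  "f \<in> nonassoc.gen_ideal leibniz_elements \<Longrightarrow> fmult f g \<in> nonassoc.gen_ideal leibniz_elements"
  using nonassoc.graded_ideal_gen_ideal[of leibniz_elements]
  unfolding nonassoc.graded_ideal_def nonassoc.is_ideal_def by blast+

lemmas leibniz_ideal_subspace =
  nonassoc.subspace_0[OF leibniz_ideal(1)]
  nonassoc.subspace_add[OF leibniz_ideal(1)]
  nonassoc.subspace_diff[OF leibniz_ideal(1)]
  nonassoc.subspace_neg[OF leibniz_ideal(1)]
  nonassoc.subspace_scale[OF leibniz_ideal(1)]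

lemma equivp_leibniz_rel:
  "equivp (leibniz_rel :: ('x::super_set, 'k::field) nonassoc \<Rightarrow> ('x, 'k) nonassoc \<Rightarrow> bool)"
proof (rule equivpI)
  show "reflp (leibniz_rel :: ('x, 'k) nonassoc \<Rightarrow> _)"
    by (auto intro!: reflpI simp: leibniz_rel_def leibniz_ideal_subspace)
  show "symp (leibniz_rel :: ('x, 'k) nonassoc \<Rightarrow> _)"
    by (rule sympI) (metis leibniz_rel_def leibniz_ideal_subspace(4) minus_diff_eq)
  show "transp (leibniz_rel :: ('x, 'k) nonassoc \<Rightarrow> _)"
  proof (rule transpI)
    fix f g h :: "('x, 'k) nonassoc"
    assume "leibniz_rel f g" "leibniz_rel g h"
    then show "leibniz_rel f h"
      unfolding leibniz_rel_def using leibniz_ideal_subspace(2)[of "f - g" "g - h"] by simp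
  qed
qed

quotient_type (overloaded) ('x, 'k) lbs =
  "('x::super_set, 'k::field) nonassoc" / leibniz_rel
  by (rule equivp_leibniz_rel)

instantiation lbs :: (super_set, field) ab_group_add
begin

lift_definition zero_lbs :: "('a, 'b) lbs" is 0 .

lift_definition plus_lbs :: "('a, 'b) lbs \<Rightarrow> ('a, 'b) lbs \<Rightarrow> ('a, 'b) lbs" is "(+)"
proof -
  fix f f' g g' :: "('a, 'b) nonassoc"
  assume "leibniz_rel f f'" "leibniz_rel g g'"
  then show "leibniz_rel (f + g) (f' + g')"
    unfolding leibniz_rel_def using leibniz_ideal_subspace(2)[of "f - f'" "g - g'"]
    by (simp add: algebra_simps)
qed

lift_definition minus_lbs :: "('a, 'b) lbs \<Rightarrow> ('a, 'b) lbs \<Rightarrow> ('a, 'b) lbs" is "(-)"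
proof -
  fix f f' g g' :: "('a, 'b) nonassoc"
  assume "leibniz_rel f f'" "leibniz_rel g g'"
  then show "leibniz_rel (f - g) (f' - g')"
    unfolding leibniz_rel_def using leibniz_ideal_subspace(3)[of "f - f'" "g - g'"]
    by (simp add: algebra_simps)
qed

lift_definition uminus_lbs :: "('a, 'b) lbs \<Rightarrow> ('a, 'b) lbs" is uminus
proof -
  fix f g :: "('a, 'b) nonassoc"
  assume "leibniz_rel f g"
  then show "leibniz_rel (- f) (- g)"
    unfolding leibniz_rel_def using leibniz_ideal_subspace(4)[of "f - g"]
    by (simp add: algebra_simps)
qed

instance
proof
  fix a b c :: "('a, 'b) lbs"
  show "a + b + c = a + (b + c)"
    by transfer (simp add: leibniz_rel_def leibniz_ideal_subspace algebra_simps)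
  show "a + b = b + a"
    by transfer (simp add: leibniz_rel_def leibniz_ideal_subspace algebra_simps)
  show "0 + a = a"
    by transfer (simp add: leibniz_rel_def leibniz_ideal_subspace algebra_simps)
  show "- a + a = 0"
    by transfer (simp add: leibniz_rel_def leibniz_ideal_subspace algebra_simps)
  show "a - b = a + - b"
    by transfer (simp add: leibniz_rel_def leibniz_ideal_subspace algebra_simps)
qed

end

instantiation lbs :: (super_set, field) times
begin

lift_definition times_lbs :: "('a, 'b) lbs \<Rightarrow> ('a, 'b) lbs \<Rightarrow> ('a, 'b) lbs" is fmult
proof -
  fix f f' g g' :: "('a, 'b) nonassoc"
  assume a: "leibniz_rel f f'" "leibniz_rel g g'"
  have "fmult f g - fmult f' g' = fmult (f - f') g + fmult f' (g - g')"
    by (simp add: nonassoc.mult_diff_left nonassoc.mult_diff_right)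
  then show "leibniz_rel (fmult f g) (fmult f' g')"
    using a leibniz_ideal(2,3) leibniz_ideal_subspace(2) unfolding leibniz_rel_def by metis
qed

instance ..

end

lift_definition lscale :: "'k::field \<Rightarrow> ('x::super_set, 'k) lbs \<Rightarrow> ('x, 'k) lbs" is fscale
  unfolding leibniz_rel_def
  by (metis leibniz_ideal_subspace(5) nonassoc.scale_right_diff_distrib)

lift_definition gen :: "'x::super_set \<Rightarrow> ('x, 'k::field) lbs"
  is "\<lambda>x. Poly_Mapping.single (Gen x) 1" .

definition lgrade :: "bit \<Rightarrow> ('x::super_set, 'k::field) lbs set"
  where "lgrade i = abs_lbs ` fgrade i"

lemma abs_lbs_eq_iff: "abs_lbs f = abs_lbs g \<longleftrightarrow> f - g \<in> nonassoc.gen_ideal leibniz_elements"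
  by (simp add: lbs.abs_eq_iff leibniz_rel_def)

lemma abs_lbs_surj: "\<exists>f. x = abs_lbs f"
  by (metis Quotient_lbs Quotient_abs_rep)

lemma abs_lbs_hom:
  "abs_lbs f + abs_lbs g = abs_lbs (f + g)"
  "abs_lbs f - abs_lbs g = abs_lbs (f - g)"
  "abs_lbs f * abs_lbs g = abs_lbs (fmult f g)"
  "lscale c (abs_lbs f) = abs_lbs (fscale c f)"
  "abs_lbs 0 = 0"
  by (simp_all add: plus_lbs.abs_eq minus_lbs.abs_eq times_lbs.abs_eq lscale.abs_eq zero_lbs_def)

lemma vector_space_lscale: "vector_space lscale"
proof
  fix a b :: 'a and x y :: "('b, 'a) lbs"
  show "lscale a (x + y) = lscale a x + lscale a y"
    by transfer (simp add: leibniz_rel_def leibniz_ideal_subspace nonassoc.scale_right_distrib)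
  show "lscale (a + b) x = lscale a x + lscale b x"
    by transfer (simp add: leibniz_rel_def leibniz_ideal_subspace nonassoc.scale_left_distrib)
  show "lscale a (lscale b x) = lscale (a * b) x"
    by transfer (simp add: leibniz_rel_def leibniz_ideal_subspace)
  show "lscale 1 x = x"
    by transfer (simp add: leibniz_rel_def leibniz_ideal_subspace)
qed

lemma lgrade_disjoint: "lgrade 0 \<inter> lgrade 1 = ({0} :: ('x::super_set, 'k::field) lbs set)"
proof -
  have "x = 0" if x: "x \<in> lgrade 0" "x \<in> lgrade 1" for x :: "('x, 'k) lbs"
  proof -
    obtain f g where fg: "f \<in> fgrade 0" "x = abs_lbs f" "g \<in> fgrade 1" "x = abs_lbs g"
      using x unfolding lgrade_def by blast
    then have "f - g \<in> nonassoc.gen_ideal leibniz_elements"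
      using abs_lbs_eq_iff by metis
    then have "\<exists>y\<in>nonassoc.gen_ideal leibniz_elements \<inter> fgrade 0.
        \<exists>z\<in>nonassoc.gen_ideal leibniz_elements \<inter> fgrade 1. f - g = y + z"
      using nonassoc.graded_ideal_gen_ideal[of leibniz_elements]
      unfolding nonassoc.graded_ideal_def by blast
    then obtain y z where yz: "y \<in> nonassoc.gen_ideal leibniz_elements \<inter> fgrade 0"
      "z \<in> nonassoc.gen_ideal leibniz_elements \<inter> fgrade 1" "f + - g = y + z"
      by auto
    have "- g \<in> fgrade 1"
      using nonassoc.grade_diff[OF nonassoc.grade_zero fg(3)] by simp
    then have "f = y"
      using nonassoc.grade_unique(1)[of f "- g" y z] fg(1) yz by auto
    then show ?thesis
      using yz(1) fg(2) abs_lbs_eq_iff[of f 0] by (simp add: abs_lbs_hom)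
  qed
  moreover have "(0 :: ('x, 'k) lbs) \<in> lgrade i" for i
    unfolding lgrade_def using nonassoc.grade_zero abs_lbs_hom(5) by (metis image_eqI)
  ultimately show ?thesis by blast
qed

lemma leibniz_superalgebra_lbs:
  "leibniz_superalgebra (lscale :: 'k::field \<Rightarrow> ('x::super_set, 'k) lbs \<Rightarrow> _) (*) lgrade"
proof (intro leibniz_superalgebra.intro superalgebra.intro superalgebra_axioms.intro
    leibniz_superalgebra_axioms.intro vector_space_lscale lgrade_disjoint)
  fix x y z :: "('x, 'k) lbs" and c :: 'k and i j l :: bit
  obtain f g h where fgh: "x = abs_lbs f" "y = abs_lbs g" "z = abs_lbs h"
    using abs_lbs_surj by metis
  show "(x + y) * z = x * z + y * z" "x * (y + z) = x * y + x * z"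
    "lscale c x * y = lscale c (x * y)" "x * lscale c y = lscale c (x * y)"
    unfolding fgh abs_lbs_hom
    by (simp_all add: nonassoc.mult_add_left nonassoc.mult_add_right
      nonassoc.mult_scale_left nonassoc.mult_scale_right)
  show "\<exists>y\<in>lgrade 0. \<exists>z\<in>lgrade 1. x = y + z"
    using nonassoc.grade_decomp[of f] unfolding fgh lgrade_def by (auto simp: abs_lbs_hom)
  show "x * y \<in> lgrade (i + j)" if "x \<in> lgrade i" "y \<in> lgrade j"
    using that nonassoc.mult_grade unfolding lgrade_def by (fastforce simp: abs_lbs_hom)
  show "x * (y * z) = x * y * z - lscale (ssign (l * j)) (x * z * y)"
    if xyz: "x \<in> lgrade i" "y \<in> lgrade j" "z \<in> lgrade l"
  proof -
    obtain f g h where fgh: "f \<in> fgrade i" "g \<in> fgrade j" "h \<in> fgrade l"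
      "x = abs_lbs f" "y = abs_lbs g" "z = abs_lbs h"
      using xyz unfolding lgrade_def by blast
    then have "fmult f (fmult g h) -
        (fmult (fmult f g) h - fscale (ssign (l * j)) (fmult (fmult f h) g)) \<in> leibniz_elements"
      unfolding leibniz_elements_def by blast
    then have "fmult f (fmult g h) -
        (fmult (fmult f g) h - fscale (ssign (l * j)) (fmult (fmult f h) g))
        \<in> nonassoc.gen_ideal leibniz_elements"
      using nonassoc.gen_ideal_superset by blast
    then show ?thesis
      unfolding fgh abs_lbs_hom abs_lbs_eq_iff .
  qed
next
  fix i
  interpret vector_space "lscale :: 'k \<Rightarrow> ('x, 'k) lbs \<Rightarrow> _" by (rule vector_space_lscale)
  show "subspace (lgrade i)"
  proof (rule subspaceI)
    show "0 \<in> lgrade i"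
      unfolding lgrade_def using nonassoc.grade_zero abs_lbs_hom(5) by (metis image_eqI)
    show "x + y \<in> lgrade i" if "x \<in> lgrade i" "y \<in> lgrade i" for x y
      using that nonassoc.grade_add unfolding lgrade_def by (fastforce simp: abs_lbs_hom)
    show "lscale c x \<in> lgrade i" if "x \<in> lgrade i" for c x
      using that nonassoc.grade_scale unfolding lgrade_def by (fastforce simp: abs_lbs_hom)
  qed
qed

global_interpretation lbs: leibniz_superalgebra lscale "(*)" lgrade
  by (rule leibniz_superalgebra_lbs)

text \<open>The universal property, which certifies that \<open>lbs\<close> is the free Leibniz superalgebra.\<close>

context leibniz_superalgebra
begin

primrec magma_eval :: "('x \<Rightarrow> 'b) \<Rightarrow> 'x magma \<Rightarrow> 'b"
  where
    "magma_eval \<phi> (Gen x) = \<phi> x"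
  | "magma_eval \<phi> (Node u v) = mult (magma_eval \<phi> u) (magma_eval \<phi> v)"

definition nonassoc_eval :: "('x \<Rightarrow> 'b) \<Rightarrow> ('x, 'a) nonassoc \<Rightarrow> 'b"
  where "nonassoc_eval \<phi> f =
    (\<Sum>m\<in>Poly_Mapping.keys f. scale (Poly_Mapping.lookup f m) (magma_eval \<phi> m))"

lemma nonassoc_eval_superset:
  assumes "finite A" "Poly_Mapping.keys f \<subseteq> A"
  shows "nonassoc_eval \<phi> f = (\<Sum>m\<in>A. scale (Poly_Mapping.lookup f m) (magma_eval \<phi> m))"
  unfolding nonassoc_eval_def
  by (rule sum.mono_neutral_left) (use assms in \<open>auto simp: in_keys_iff\<close>)

lemma nonassoc_eval_single: "nonassoc_eval \<phi> (Poly_Mapping.single m 1) = magma_eval \<phi> m"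
  by (simp add: nonassoc_eval_def)

lemma nonassoc_eval_add: "nonassoc_eval \<phi> (f + g) = nonassoc_eval \<phi> f + nonassoc_eval \<phi> g"
proof -
  let ?A = "Poly_Mapping.keys f \<union> Poly_Mapping.keys g"
  have "Poly_Mapping.keys (f + g) \<subseteq> ?A" by (rule keys_add)
  then show ?thesis
    by (simp add: nonassoc_eval_superset[of ?A] lookup_add scale_left_distrib sum.distrib)
qed

lemma nonassoc_eval_scale: "nonassoc_eval \<phi> (fscale c f) = scale c (nonassoc_eval \<phi> f)"
proof -
  have "Poly_Mapping.keys (fscale c f) \<subseteq> Poly_Mapping.keys f"
    by (auto simp: in_keys_iff)
  then show ?thesis
    by (simp add: nonassoc_eval_superset[of "Poly_Mapping.keys f"] scale_sum_right)
qed

lemma nonassoc_eval_diff: "nonassoc_eval \<phi> (f - g) = nonassoc_eval \<phi> f - nonassoc_eval \<phi> g"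
  using nonassoc_eval_add[of \<phi> "f - g" g] by (simp add: algebra_simps)

lemma nonassoc_eval_mult:
  "nonassoc_eval \<phi> (fmult f g) = mult (nonassoc_eval \<phi> f) (nonassoc_eval \<phi> g)"
proof -
  let ?F = "Poly_Mapping.keys f" and ?G = "Poly_Mapping.keys g"
  let ?N = "\<lambda>(u, v). Node u v"
  have suml: "mult (sum h A) y = (\<Sum>a\<in>A. mult (h a) y)" for h :: "'c magma \<Rightarrow> 'b" and A y
    by (induction A rule: infinite_finite_induct) (auto simp: mult_zero_left mult_add_left)
  have sumr: "mult y (sum h A) = (\<Sum>a\<in>A. mult y (h a))" for h :: "'c magma \<Rightarrow> 'b" and A y
    by (induction A rule: infinite_finite_induct) (auto simp: mult_zero_right mult_add_right)
  have inj: "inj_on ?N (?F \<times> ?G)" by (auto simp: inj_on_def)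
  have "Poly_Mapping.keys (fmult f g) \<subseteq> ?N ` (?F \<times> ?G)"
  proof
    fix m assume "m \<in> Poly_Mapping.keys (fmult f g)"
    then show "m \<in> ?N ` (?F \<times> ?G)"
      by (cases m) (auto simp: in_keys_iff lookup_fmult)
  qed
  then have "nonassoc_eval \<phi> (fmult f g) =
      (\<Sum>m\<in>?N ` (?F \<times> ?G). scale (Poly_Mapping.lookup (fmult f g) m) (magma_eval \<phi> m))"
    by (intro nonassoc_eval_superset) auto
  also have "\<dots> = (\<Sum>(u, v)\<in>?F \<times> ?G. scale (Poly_Mapping.lookup f u * Poly_Mapping.lookup g v)
      (mult (magma_eval \<phi> u) (magma_eval \<phi> v)))"
    by (subst sum.reindex[OF inj]) (auto intro!: sum.cong simp: lookup_fmult)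
  also have "\<dots> = (\<Sum>u\<in>?F. \<Sum>v\<in>?G. scale (Poly_Mapping.lookup f u * Poly_Mapping.lookup g v)
      (mult (magma_eval \<phi> u) (magma_eval \<phi> v)))"
    by (rule sum.cartesian_product[symmetric])
  also have "\<dots> = mult (nonassoc_eval \<phi> f) (nonassoc_eval \<phi> g)"
    unfolding nonassoc_eval_def suml sumr
    by (simp add: mult_scale_left mult_scale_right mult.commute) (rule sum.swap)
  finally show ?thesis .
qed

lemma nonassoc_eval_grade:
  fixes \<phi> :: "'x::super_set \<Rightarrow> 'b"
  assumes \<phi>: "\<And>x. \<phi> x \<in> grade (parity x)" and f: "f \<in> fgrade i"
  shows "nonassoc_eval \<phi> f \<in> grade i"
proof -
  have "magma_eval \<phi> m \<in> grade (magma_parity m)" for m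
    by (induction m) (simp_all only: magma_eval.simps magma_parity.simps \<phi> mult_grade)
  then have "scale (Poly_Mapping.lookup f m) (magma_eval \<phi> m) \<in> grade i"
    if "m \<in> Poly_Mapping.keys f" for m
    using that f by (metis (mono_tags, lifting) fgrade_def grade_scale in_keys_iff mem_Collect_eq)
  then show ?thesis
    unfolding nonassoc_eval_def by (intro subspace_sum[OF subspace_grade])
qed

lemma nonassoc_eval_leibniz_ideal:
  fixes \<phi> :: "'x::super_set \<Rightarrow> 'b"
  assumes \<phi>: "\<And>x. \<phi> x \<in> grade (parity x)" and f: "f \<in> nonassoc.gen_ideal leibniz_elements"
  shows "nonassoc_eval \<phi> f = 0"
proof -
  let ?K = "{f. nonassoc_eval \<phi> f = 0}"
  have z: "nonassoc_eval \<phi> 0 = 0" by (simp add: nonassoc_eval_def)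
  have sub: "nonassoc.subspace ?K"
    by (rule nonassoc.subspaceI) (auto simp: z nonassoc_eval_add nonassoc_eval_scale)
  have "\<exists>y\<in>?K \<inter> fgrade 0. \<exists>z\<in>?K \<inter> fgrade 1. x = y + z" if x: "x \<in> ?K" for x
  proof -
    obtain y z where yz: "y \<in> fgrade 0" "z \<in> fgrade 1" "x = y + z"
      using nonassoc.grade_decomp by blast
    have "nonassoc_eval \<phi> y + nonassoc_eval \<phi> z = 0 + 0"
      using x yz(3) by (simp add: nonassoc_eval_add)
    then have "nonassoc_eval \<phi> y = 0" "nonassoc_eval \<phi> z = 0"
      using grade_unique[of "nonassoc_eval \<phi> y" "nonassoc_eval \<phi> z" 0 0]
        nonassoc_eval_grade[OF \<phi>] yz grade_zero by auto
    then show ?thesis using yz by blast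
  qed
  then have "nonassoc.graded_ideal ?K"
    unfolding nonassoc.graded_ideal_def nonassoc.is_ideal_def
    using sub by (auto simp: nonassoc_eval_mult mult_zero_left mult_zero_right)
  moreover have "leibniz_elements \<subseteq> ?K"
  proof
    fix e :: "('x, 'a) nonassoc"
    assume "e \<in> leibniz_elements"
    then obtain x y z i j l where e: "x \<in> fgrade i" "y \<in> fgrade j" "z \<in> fgrade l"
      "e = fmult x (fmult y z) -
        (fmult (fmult x y) z - fscale (ssign (l * j)) (fmult (fmult x z) y))"
      unfolding leibniz_elements_def by blast
    then show "e \<in> ?K"
      using leibniz[OF e(1-3)[THEN nonassoc_eval_grade[OF \<phi>]]]
      by (simp add: nonassoc_eval_diff nonassoc_eval_mult nonassoc_eval_scale)
  qed
  ultimately show ?thesis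
    using nonassoc.gen_ideal_minimal f by blast
qed

end

lemma gen_grade: "gen x \<in> lgrade (parity x)"
proof -
  have "Poly_Mapping.single (Gen x) 1 \<in> fgrade (parity x)"
    by (auto simp: fgrade_def lookup_single when_def)
  then show ?thesis by (auto simp: lgrade_def gen.abs_eq)
qed

theorem lbs_universal:
  fixes \<phi> :: "'x::super_set \<Rightarrow> 'a::ab_group_add" and scale :: "'k::field \<Rightarrow> 'a \<Rightarrow> 'a"
  assumes "leibniz_superalgebra scale mult grade"
    and \<phi>: "\<And>x. \<phi> x \<in> grade (parity x)"
  shows "\<exists>!h. superalgebra_hom lscale (*) lgrade scale mult grade h \<and> (\<forall>x. h (gen x) = \<phi> x)"
proof -
  interpret B: leibniz_superalgebra scale mult grade by fact
  note hom = B.nonassoc_eval_add B.nonassoc_eval_scale B.nonassoc_eval_mult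
  define h :: "('x, 'k) lbs \<Rightarrow> 'a" where "h x = B.nonassoc_eval \<phi> (rep_lbs x)" for x
  have h_abs: "h (abs_lbs f) = B.nonassoc_eval \<phi> f" for f
  proof -
    have "abs_lbs (rep_lbs (abs_lbs f)) = abs_lbs f"
      by (metis Quotient_lbs Quotient_abs_rep)
    then have "B.nonassoc_eval \<phi> (rep_lbs (abs_lbs f) - f) = 0"
      unfolding abs_lbs_eq_iff by (rule B.nonassoc_eval_leibniz_ideal[OF \<phi>])
    then show ?thesis by (simp add: h_def B.nonassoc_eval_diff)
  qed
  have "h (x + y) = h x + h y" "h (lscale c x) = scale c (h x)" "h (x * y) = mult (h x) (h y)"
    for x y c
  proof -
    obtain f g where "x = abs_lbs f" "y = abs_lbs g" using abs_lbs_surj by metis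
    then show "h (x + y) = h x + h y" "h (lscale c x) = scale c (h x)"
      "h (x * y) = mult (h x) (h y)"
      by (simp_all add: abs_lbs_hom h_abs hom)
  qed
  moreover have "h ` lgrade i \<subseteq> grade i" for i
    using B.nonassoc_eval_grade[OF \<phi>] by (auto simp: lgrade_def h_abs)
  ultimately have "superalgebra_hom lscale (*) lgrade scale mult grade h"
    unfolding superalgebra_hom_def
    by (auto intro!: Vector_Spaces.linear.intro module_hom.intro module_hom_axioms.intro
      B.vector_space_axioms lbs.vector_space_axioms B.module_axioms lbs.module_axioms)
  moreover have "h (gen x) = \<phi> x" for x
    by (simp add: gen.abs_eq h_abs B.nonassoc_eval_single)
  moreover have "h1 = h2"
    if h1: "superalgebra_hom lscale (*) lgrade scale mult grade h1" "\<forall>x. h1 (gen x) = \<phi> x"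
    and h2: "superalgebra_hom lscale (*) lgrade scale mult grade h2" "\<forall>x. h2 (gen x) = \<phi> x"
    for h1 h2 :: "('x, 'k) lbs \<Rightarrow> 'a"
  proof
    fix x :: "('x, 'k) lbs"
    obtain f where f: "x = abs_lbs f" using abs_lbs_surj by blast
    have l1: "Vector_Spaces.linear lscale scale h1" and l2: "Vector_Spaces.linear lscale scale h2"
      using h1 h2 by (auto simp: superalgebra_hom_def)
    interpret L1: Vector_Spaces.linear lscale scale h1 by (rule l1)
    interpret L2: Vector_Spaces.linear lscale scale h2 by (rule l2)
    have mono: "h1 (abs_lbs (Poly_Mapping.single m 1)) = h2 (abs_lbs (Poly_Mapping.single m 1))" for m
    proof (induction m)
      case (Gen x)
      then show ?case using h1(2) h2(2) by (simp add: gen.abs_eq)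
    next
      case (Node u v)
      then show ?case
        using h1(1) h2(1)
        by (simp add: superalgebra_hom_def fmult_single[symmetric] abs_lbs_hom(3)[symmetric])
    qed
    have "h1 (abs_lbs f) = h2 (abs_lbs f)"
    proof (induction f rule: update_induct)
      case const
      then show ?case by (simp add: abs_lbs_hom(5) L1.zero L2.zero)
    next
      case (update f m c)
      have "Poly_Mapping.update m c f = f + fscale c (Poly_Mapping.single m 1)"
        by (rule poly_mapping_eqI)
          (use update(1) in \<open>auto simp: lookup_update lookup_add lookup_single in_keys_iff when_def\<close>)
      then show ?case
        using mono update.IH
        by (simp add: abs_lbs_hom(1,4)[symmetric] L1.add L2.add L1.scale L2.scale)
    qed
    then show "h1 x = h2 x" using f by simp
  qed
  ultimately show ?thesis by blast
qed

section \<open>Normal forms and the deg-length-lex order\<close>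

definition left_normed :: "('x::super_set, 'k::field) lbs list \<Rightarrow> ('x, 'k) lbs"
  where "left_normed fs = foldl (*) (hd fs) (tl fs)"

definition nf :: "'x::super_set list \<Rightarrow> ('x, 'k::field) lbs"
  where "nf w = left_normed (map gen w)"

definition NF :: "('x::super_set, 'k::field) lbs set"
  where "NF = nf ` {w. w \<noteq> []}"

text \<open>\<open>NF\<close> is a linear basis and different words give different elements of it, so every
  element of \<open>NF\<close> has a well-defined word of letters and every element of the algebra has
  well-defined coefficients.\<close>

definition word_of :: "('x::super_set, 'k::field) lbs \<Rightarrow> 'x list"
  where "word_of \<mu> = inv_into {w. w \<noteq> []} nf \<mu>"

definition nf_length :: "('x::super_set, 'k::field) lbs \<Rightarrow> nat"
  where "nf_length \<mu> = length (word_of \<mu>)"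

definition nf_parity :: "('x::super_set, 'k::field) lbs \<Rightarrow> bit"
  where "nf_parity \<mu> = (\<Sum>a\<leftarrow>word_of \<mu>. parity a)"

definition nf_deg :: "('x::super_set \<Rightarrow> nat) \<Rightarrow> ('x, 'k::field) lbs \<Rightarrow> nat"
  where "nf_deg deg \<mu> = (\<Sum>a\<leftarrow>word_of \<mu>. deg a)"

definition wt :: "('x::super_set \<Rightarrow> nat) \<Rightarrow> ('x, 'k::field) lbs \<Rightarrow> nat \<times> nat \<times> 'x list"
  where "wt deg \<mu> = (nf_deg deg \<mu>, nf_length \<mu>, word_of \<mu>)"

definition nf_less ::
  "('x::{super_set,wellorder} \<Rightarrow> nat) \<Rightarrow> ('x, 'k::field) lbs \<Rightarrow> ('x, 'k) lbs \<Rightarrow> bool"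
  where "nf_less deg \<mu> \<nu> \<longleftrightarrow>
    (wt deg \<mu>, wt deg \<nu>) \<in> less_than <*lex*> less_than <*lex*> lex {(a, b). a < b}"

definition coeff :: "('x::super_set, 'k::field) lbs \<Rightarrow> ('x, 'k) lbs \<Rightarrow> 'k"
  where "coeff f \<mu> = lbs.representation NF f \<mu>"

definition monomials :: "('x::super_set, 'k::field) lbs \<Rightarrow> ('x, 'k) lbs set"
  where "monomials f = {\<mu>\<in>NF. coeff f \<mu> \<noteq> 0}"

text \<open>Meaningful for \<open>f \<noteq> 0\<close> only.\<close>

definition lead :: "('x::{super_set,wellorder} \<Rightarrow> nat) \<Rightarrow> ('x, 'k::field) lbs \<Rightarrow> ('x, 'k) lbs"
  where "lead deg f = (THE \<mu>. \<mu> \<in> monomials f \<and> (\<forall>\<nu>\<in>monomials f. \<nu> \<noteq> \<mu> \<longrightarrow> nf_less deg \<nu> \<mu>))"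

definition monic :: "('x::{super_set,wellorder} \<Rightarrow> nat) \<Rightarrow> ('x, 'k::field) lbs \<Rightarrow> bool"
  where "monic deg f \<longleftrightarrow> f \<noteq> 0 \<and> coeff f (lead deg f) = 1"

definition homogeneous :: "('x::super_set, 'k::field) lbs \<Rightarrow> bool"
  where "homogeneous f \<longleftrightarrow> (\<exists>i. \<forall>\<mu>\<in>monomials f. nf_parity \<mu> = i)"

section \<open>Normal polynomials and Groebner-Shirshov bases\<close>

text \<open>The normal \<open>S\<close>-polynomials \<open>h\<^sub>s\<close> built from a given \<open>s\<close>.\<close>

definition normal_polys_of ::
  "('x::{super_set,wellorder} \<Rightarrow> nat) \<Rightarrow> ('x, 'k::field) lbs \<Rightarrow> ('x, 'k) lbs set"
  where "normal_polys_of deg s =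
    {left_normed (s # map gen as) | as. True} \<union>
    {left_normed (map gen as @ s # map gen bs) | as bs. as \<noteq> [] \<and> nf_length (lead deg s) = 1}"

definition normal_polys ::
  "('x::{super_set,wellorder} \<Rightarrow> nat) \<Rightarrow> ('x, 'k::field) lbs set \<Rightarrow> ('x, 'k) lbs set"
  where "normal_polys deg S = (\<Union>s\<in>S. normal_polys_of deg s)"

definition trivial_mod ::
  "('x::{super_set,wellorder} \<Rightarrow> nat) \<Rightarrow> ('x, 'k::field) lbs set \<Rightarrow> ('x, 'k) lbs \<Rightarrow> ('x, 'k) lbs \<Rightarrow> bool"
  where "trivial_mod deg S \<mu> h \<longleftrightarrow> h \<in> lbs.span {p \<in> normal_polys deg S. nf_less deg (lead deg p) \<mu>}"

definition trivial_mod_deg ::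
  "('x::{super_set,wellorder} \<Rightarrow> nat) \<Rightarrow> ('x, 'k::field) lbs set \<Rightarrow> nat \<Rightarrow> ('x, 'k) lbs \<Rightarrow> bool"
  where "trivial_mod_deg deg S n h \<longleftrightarrow>
    h \<in> lbs.span {p \<in> normal_polys deg S. nf_deg deg (lead deg p) \<le> n}"

definition gs_basis :: "('x::{super_set,wellorder} \<Rightarrow> nat) \<Rightarrow> ('x, 'k::field) lbs set \<Rightarrow> bool"
  where "gs_basis deg S \<longleftrightarrow>
    (\<forall>f\<in>S. \<forall>\<mu>\<in>NF. nf_length (lead deg f) > 1 \<and> \<mu> * f \<noteq> 0 \<longrightarrow>
      trivial_mod_deg deg S (nf_deg deg \<mu> + nf_deg deg (lead deg f)) (\<mu> * f)) \<and>
    (\<forall>f\<in>S. \<forall>g\<in>S. \<forall>h\<in>normal_polys_of deg g. f \<noteq> g \<and> lead deg f = lead deg h \<longrightarrow>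
      trivial_mod deg S (lead deg f) (f - h))"

definition Irr ::
  "('x::{super_set,wellorder} \<Rightarrow> nat) \<Rightarrow> ('x, 'k::field) lbs set \<Rightarrow> ('x, 'k) lbs set"
  where "Irr deg S = {\<tau>\<in>NF. \<forall>h\<in>normal_polys deg S. \<tau> \<noteq> lead deg h}"

section \<open>Quotients\<close>

text \<open>The quotient by an ideal \<open>I\<close> has the cosets of \<open>I\<close> as elements. Since \<open>I\<close> is not part of
  a type, the quotient is given as a carrier set with explicit operations, and linear bases are
  defined relative to such a carrier.\<close>

definition coset :: "'a::ab_group_add set \<Rightarrow> 'a \<Rightarrow> 'a set"
  where "coset I f = {f + i | i. i \<in> I}"

context superalgebra
begin

definition quot :: "'a set \<Rightarrow> 'a set set"
  where "quot I = range (coset I)"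

definition quot_add :: "'a set \<Rightarrow> 'a set \<Rightarrow> 'a set \<Rightarrow> 'a set"
  where "quot_add I A B = {a + b + i | a b i. a \<in> A \<and> b \<in> B \<and> i \<in> I}"

definition quot_scale :: "'a set \<Rightarrow> 'k \<Rightarrow> 'a set \<Rightarrow> 'a set"
  where "quot_scale I c A = {scale c a + i | a i. a \<in> A \<and> i \<in> I}"

definition quot_mult :: "'a set \<Rightarrow> 'a set \<Rightarrow> 'a set \<Rightarrow> 'a set"
  where "quot_mult I A B = {mult a b + i | a b i. a \<in> A \<and> b \<in> B \<and> i \<in> I}"

definition quot_grade :: "'a set \<Rightarrow> bit \<Rightarrow> 'a set set"
  where "quot_grade I i = coset I ` grade i"

definition quot_subspace :: "'a set \<Rightarrow> 'a set set \<Rightarrow> bool"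
  where "quot_subspace I W \<longleftrightarrow> W \<subseteq> quot I \<and> coset I 0 \<in> W \<and>
    (\<forall>A\<in>W. \<forall>B\<in>W. quot_add I A B \<in> W) \<and> (\<forall>c. \<forall>A\<in>W. quot_scale I c A \<in> W)"

definition quot_span :: "'a set \<Rightarrow> 'a set set \<Rightarrow> 'a set set"
  where "quot_span I P = quot_subspace I hull P"

text \<open>The images of the elements of \<open>T\<close> form a linear basis of the quotient by \<open>I\<close>, as a
  family indexed by \<open>T\<close>: distinct elements of \<open>T\<close> have distinct images.\<close>

definition basis_of_quot :: "'a set \<Rightarrow> 'a set \<Rightarrow> bool"
  where "basis_of_quot I T \<longleftrightarrow> inj_on (coset I) T \<and>
    quot_span I (coset I ` T) = quot I \<and>
    (\<forall>A\<in>coset I ` T. A \<notin> quot_span I (coset I ` T - {A}))"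

lemma coset_eq_iff:
  assumes "subspace I"
  shows "coset I f = coset I g \<longleftrightarrow> f - g \<in> I"
proof
  assume "coset I f = coset I g"
  moreover have "f \<in> coset I f"
    using subspace_0[OF assms] by (force simp: coset_def)
  ultimately show "f - g \<in> I" by (auto simp: coset_def)
next
  assume fg: "f - g \<in> I"
  have "f + i = g + (f - g + i)" "g + i = f + (i - (f - g))" for i
    by auto
  then show "coset I f = coset I g"
    using fg subspace_add[OF assms] subspace_diff[OF assms] unfolding coset_def by blast
qed

lemma quot_add_coset:
  assumes "subspace I"
  shows "quot_add I (coset I f) (coset I g) = coset I (f + g)"
proof
  show "quot_add I (coset I f) (coset I g) \<subseteq> coset I (f + g)"
  proof
    fix x assume "x \<in> quot_add I (coset I f) (coset I g)"
    then obtain i j l where "i \<in> I" "j \<in> I" "l \<in> I" "x = (f + i) + (g + j) + l"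
      unfolding quot_add_def coset_def by blast
    then have "i + j + l \<in> I" "x = f + g + (i + j + l)"
      using subspace_add[OF assms] by (auto simp: algebra_simps)
    then show "x \<in> coset I (f + g)" unfolding coset_def by blast
  qed
  show "coset I (f + g) \<subseteq> quot_add I (coset I f) (coset I g)"
    using subspace_0[OF assms] unfolding quot_add_def coset_def by force
qed

lemma quot_scale_coset:
  assumes "subspace I"
  shows "quot_scale I c (coset I f) = coset I (scale c f)"
proof
  show "quot_scale I c (coset I f) \<subseteq> coset I (scale c f)"
  proof
    fix x assume "x \<in> quot_scale I c (coset I f)"
    then obtain i j where "i \<in> I" "j \<in> I" "x = scale c (f + i) + j"
      unfolding quot_scale_def coset_def by blast
    then have "scale c i + j \<in> I" "x = scale c f + (scale c i + j)"
      using subspace_add[OF assms] subspace_scale[OF assms]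
      by (auto simp: scale_right_distrib algebra_simps)
    then show "x \<in> coset I (scale c f)" unfolding coset_def by blast
  qed
  show "coset I (scale c f) \<subseteq> quot_scale I c (coset I f)"
    using subspace_0[OF assms] unfolding quot_scale_def coset_def by force
qed

lemma quot_mult_coset:
  assumes "is_ideal I"
  shows "quot_mult I (coset I f) (coset I g) = coset I (mult f g)"
proof
  have s: "subspace I" and m: "\<And>x a. x \<in> I \<Longrightarrow> mult a x \<in> I" "\<And>x a. x \<in> I \<Longrightarrow> mult x a \<in> I"
    using assms by (auto simp: is_ideal_def)
  show "quot_mult I (coset I f) (coset I g) \<subseteq> coset I (mult f g)"
  proof
    fix x assume "x \<in> quot_mult I (coset I f) (coset I g)"
    then obtain i j l where "i \<in> I" "j \<in> I" "l \<in> I" "x = mult (f + i) (g + j) + l"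
      unfolding quot_mult_def coset_def by blast
    then have "mult f j + mult i (g + j) + l \<in> I"
      "x = mult f g + (mult f j + mult i (g + j) + l)"
      using subspace_add[OF s] m by (auto simp: mult_add_left mult_add_right algebra_simps)
    then show "x \<in> coset I (mult f g)" unfolding coset_def by blast
  qed
  show "coset I (mult f g) \<subseteq> quot_mult I (coset I f) (coset I g)"
    using subspace_0[OF s] unfolding quot_mult_def coset_def by force
qed

end

end

theory Submission
  imports Defs "HOL-Library.Product_Plus" "HOL-Library.Multiset"
begin

text \<open>That left-normed words are independent is seen in the free associative superalgebra \<open>A\<close>: the
  space \<open>A \<times> A\<close> with product \<open>(f, r) (g, s) = (f s, [r, s])\<close> is a Leibniz superalgebra, and the
  homomorphism sending each generator \<open>x\<close> to \<open>(x, x)\<close> maps a left-normed word to a pair whose first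
  component is that word.

  If \<open>S\<close> is a Groebner-Shirshov basis, the Leibniz identity moves every multiplication onto letters,
  so the normal polynomials span the ideal, with control of degrees. Two normal polynomials with the
  same leading word differ by normal polynomials with smaller leading words: the reduced parts of
  the word are either nested, which is an inclusion composition, or disjoint, or the same letter,
  where the degree bound on left multiplication is needed. Hence leading words cannot cancel.
  Conversely, modulo normal polynomials every element reduces to a combination of irreducible words
  not exceeding its leading word, and statements (ii) and (iii) both say that no nonzero such
  combination lies in the ideal.\<close>

section \<open>Left-normed words form a basis\<close>

datatype 'x free_monoid = Word (letters: "'x list")

instantiation free_monoid :: (type) monoid_add
begin

definition zero_free_monoid :: "'a free_monoid"
  where "0 = Word []"

definition plus_free_monoid :: "'a free_monoid \<Rightarrow> 'a free_monoid \<Rightarrow> 'a free_monoid"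
  where "u + v = Word (letters u @ letters v)"

instance
  by standard (simp_all add: zero_free_monoid_def plus_free_monoid_def)

end

text \<open>Polynomial mappings multiply by convolution over an additively written monoid of
  exponents. With concatenation as addition, this is the product of the free associative
  algebra.\<close>

type_synonym ('x, 'k) free_assoc = "'x free_monoid \<Rightarrow>\<^sub>0 'k"

definition word_parity :: "'x::super_set free_monoid \<Rightarrow> bit"
  where "word_parity u = (\<Sum>a\<leftarrow>letters u. parity a)"

lemma word_parity_add: "word_parity (u + v) = word_parity u + word_parity v"
  by (simp add: word_parity_def plus_free_monoid_def)

text \<open>Encoded as multiplication by a constant, so that the vector space laws come from those
  of the ring.\<close>

definition ascale :: "'k::field \<Rightarrow> ('x, 'k) free_assoc \<Rightarrow> ('x, 'k) free_assoc"
  where "ascale c f = Poly_Mapping.single 0 c * f"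

lemma lookup_ascale: "Poly_Mapping.lookup (ascale c f) u = c * Poly_Mapping.lookup f u"
proof -
  have "ascale c f = Poly_Mapping.map ((*) c) f"
    unfolding ascale_def by (simp add: mult_map_scale_conv_mult)
  then show ?thesis by (simp add: map.rep_eq when_def)
qed

text \<open>The empty word is neutral on both sides and the coefficients commute. Centrality is what
  lets a scalar leave the right factor in \<open>ascale_mult\<close>.\<close>

lemma single_zero_central:
  fixes f :: "('x, 'k::field) free_assoc"
  shows "f * Poly_Mapping.single 0 c = Poly_Mapping.single 0 c * f"
proof (induction f rule: update_induct)
  case (update f u b)
  have "Poly_Mapping.update u b f = f + Poly_Mapping.single u b"
    by (rule poly_mapping_eqI)
      (use update(1) in \<open>auto simp: lookup_update lookup_add lookup_single in_keys_iff when_def\<close>)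
  with update show ?case by (simp add: distrib_left distrib_right mult_single mult.commute)
qed simp

lemma vector_space_ascale: "vector_space ascale"
  by standard (simp_all add: ascale_def algebra_simps single_add mult_single flip: mult.assoc)

interpretation free_assoc: vector_space ascale
  by (rule vector_space_ascale)

lemma ascale_mult:
  "ascale c f * g = ascale c (f * g)" "f * ascale c g = ascale c (f * g)"
proof -
  show "ascale c f * g = ascale c (f * g)"
    by (simp add: ascale_def mult.assoc)
  show "f * ascale c g = ascale c (f * g)"
    unfolding ascale_def by (metis mult.assoc single_zero_central)
qed

definition agrade :: "bit \<Rightarrow> ('x::super_set, 'k::field) free_assoc set"
  where "agrade i = {f. \<forall>u. Poly_Mapping.lookup f u \<noteq> 0 \<longrightarrow> word_parity u = i}"

lemma subspace_agrade:
  "free_assoc.subspace (agrade i :: ('x::super_set, 'k::field) free_assoc set)"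
proof (rule free_assoc.subspaceI)
  fix x y :: "('x, 'k) free_assoc"
  assume "x \<in> agrade i" "y \<in> agrade i"
  then show "x + y \<in> agrade i"
    unfolding agrade_def lookup_add mem_Collect_eq by (metis add_0)
qed (auto simp: agrade_def lookup_ascale)

lemma agrade_mult: "x \<in> agrade i \<Longrightarrow> y \<in> agrade j \<Longrightarrow> x * y \<in> agrade (i + j)"
  for x y :: "('x::super_set, 'k::field) free_assoc"
proof -
  assume xy: "x \<in> agrade i" "y \<in> agrade j"
  show ?thesis
    unfolding agrade_def
  proof (intro CollectI allI impI)
    fix u assume "Poly_Mapping.lookup (x * y) u \<noteq> 0"
    then have "u \<in> {a + b |a b. a \<in> Poly_Mapping.keys x \<and> b \<in> Poly_Mapping.keys y}"
      using keys_mult[of x y] unfolding in_keys_iff[symmetric] by blast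
    then obtain a b where "a \<in> Poly_Mapping.keys x" "b \<in> Poly_Mapping.keys y" "u = a + b"
      by blast
    with xy show "word_parity u = i + j"
      by (simp add: agrade_def word_parity_add in_keys_iff)
  qed
qed

text \<open>The projection onto the component of parity \<open>i\<close>.\<close>

lift_definition apart :: "bit \<Rightarrow> ('x::super_set, 'k::field) free_assoc \<Rightarrow> ('x, 'k) free_assoc"
  is "\<lambda>i f u. if word_parity u = i then f u else 0"
  by (auto elim: finite_subset[rotated])

lemma lookup_apart:
  "Poly_Mapping.lookup (apart i f) u = (if word_parity u = i then Poly_Mapping.lookup f u else 0)"
  by transfer simp

lemma apart_linear:
  "apart i (f + g) = apart i f + apart i g"
  "apart i (ascale c f) = ascale c (apart i f)"
  by (auto intro!: poly_mapping_eqI simp: lookup_apart lookup_add lookup_ascale)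

lemma apart_agrade: "f \<in> agrade j \<Longrightarrow> apart i f = (if i = j then f else 0)"
  by (rule poly_mapping_eqI) (auto simp: agrade_def lookup_apart)

text \<open>On homogeneous elements this is \<open>r s - (-1)\<^sup>|\<^sup>r\<^sup>|\<^sup>|\<^sup>s\<^sup>| s r\<close>: the last summand corrects the
  sign when both arguments are odd.\<close>

definition supercommutator ::
  "('x::super_set, 'k::field) free_assoc \<Rightarrow> ('x, 'k) free_assoc \<Rightarrow> ('x, 'k) free_assoc"
  where "supercommutator r s = r * s - s * r + (apart 1 s * apart 1 r + apart 1 s * apart 1 r)"

lemma supercommutator_bilinear:
  "supercommutator (r + r') s = supercommutator r s + supercommutator r' s"
  "supercommutator r (s + s') = supercommutator r s + supercommutator r s'"
  "supercommutator (ascale c r) s = ascale c (supercommutator r s)"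
  "supercommutator r (ascale c s) = ascale c (supercommutator r s)"
  by (simp_all add: supercommutator_def apart_linear ascale_mult distrib_left distrib_right
    free_assoc.scale_right_distrib free_assoc.scale_right_diff_distrib)

lemma supercommutator_homogeneous:
  "r \<in> agrade i \<Longrightarrow> s \<in> agrade j \<Longrightarrow> supercommutator r s = r * s - ascale (ssign (i * j)) (s * r)"
  by (cases i; cases j) (simp_all add: supercommutator_def apart_agrade ssign_def)

lemma supercommutator_agrade:
  assumes "r \<in> agrade i" "s \<in> agrade j"
  shows "supercommutator r s \<in> agrade (i + j)"
proof -
  have "s * r \<in> agrade (i + j)"
    using agrade_mult[OF assms(2,1)] by (simp only: add.commute)
  then show ?thesis
    unfolding supercommutator_homogeneous[OF assms]
    by (intro free_assoc.subspace_diff free_assoc.subspace_scale subspace_agrade)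
      (use agrade_mult[OF assms] in auto)
qed

text \<open>The Jacobi identity of the Lie superalgebra attached to an associative superalgebra,
  arranged as a right Leibniz identity: after expansion all associative monomials cancel.\<close>

lemma supercommutator_leibniz:
  assumes "r \<in> agrade i" "s \<in> agrade j" "t \<in> agrade l"
  shows "supercommutator r (supercommutator s t) = supercommutator (supercommutator r s) t
    - ascale (ssign (l * j)) (supercommutator (supercommutator r t) s)"
proof -
  note h = supercommutator_homogeneous
  have "supercommutator r (supercommutator s t) =
      r * (s * t - ascale (ssign (j * l)) (t * s))
      - ascale (ssign (i * (j + l))) ((s * t - ascale (ssign (j * l)) (t * s)) * r)"
    using h[OF assms(1) supercommutator_agrade[OF assms(2,3)]] by (simp add: h[OF assms(2,3)])
  moreover have "supercommutator (supercommutator r s) t =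
      (r * s - ascale (ssign (i * j)) (s * r)) * t
      - ascale (ssign ((i + j) * l)) (t * (r * s - ascale (ssign (i * j)) (s * r)))"
    using h[OF supercommutator_agrade[OF assms(1,2)] assms(3)] by (simp add: h[OF assms(1,2)])
  moreover have "supercommutator (supercommutator r t) s =
      (r * t - ascale (ssign (i * l)) (t * r)) * s
      - ascale (ssign ((i + l) * j)) (s * (r * t - ascale (ssign (i * l)) (t * r)))"
    using h[OF supercommutator_agrade[OF assms(1,3)] assms(2)] by (simp add: h[OF assms(1,3)])
  ultimately show ?thesis
    \<comment> \<open>Fixing the eight choices of parities turns each sign into 1 or -1, which
      leaves an identity in the ring.\<close>
    by (simp only:) (cases i; cases j; cases l; simp add: ssign_def algebra_simps)
qed

lemma ssign_commute: "ssign (i * j) = (ssign (j * i) :: 'k::field)"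
  by (simp add: mult.commute)

section \<open>A Leibniz superalgebra of pairs that detects left-normed words\<close>

definition pscale :: "'k::field \<Rightarrow> ('x, 'k) free_assoc \<times> ('x, 'k) free_assoc
    \<Rightarrow> ('x, 'k) free_assoc \<times> ('x, 'k) free_assoc"
  where "pscale c p = (ascale c (fst p), ascale c (snd p))"

definition pmult :: "('x::super_set, 'k::field) free_assoc \<times> ('x, 'k) free_assoc
    \<Rightarrow> ('x, 'k) free_assoc \<times> ('x, 'k) free_assoc \<Rightarrow> ('x, 'k) free_assoc \<times> ('x, 'k) free_assoc"
  where "pmult p q = (fst p * snd q, supercommutator (snd p) (snd q))"

definition pgrade :: "bit \<Rightarrow> (('x::super_set, 'k::field) free_assoc \<times> ('x, 'k) free_assoc) set"
  where "pgrade i = agrade i \<times> agrade i"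

text \<open>The first factor is a right module over the second one, which is a Lie superalgebra; this
  is why the product is Leibniz.\<close>

lemma leibniz_superalgebra_pmult: "leibniz_superalgebra pscale pmult pgrade"
proof (intro leibniz_superalgebra.intro superalgebra.intro superalgebra_axioms.intro
    leibniz_superalgebra_axioms.intro)
  show vs: "vector_space (pscale :: 'k::field \<Rightarrow> ('x, 'k) free_assoc \<times> ('x, 'k) free_assoc \<Rightarrow> _)"
    by standard (simp_all add: pscale_def free_assoc.scale_right_distrib free_assoc.scale_left_distrib)
  fix x y z :: "('x::super_set, 'k::field) free_assoc \<times> ('x, 'k) free_assoc" and c :: 'k and i j l
  show "pmult (x + y) z = pmult x z + pmult y z" "pmult x (y + z) = pmult x y + pmult x z"
    "pmult (pscale c x) y = pscale c (pmult x y)" "pmult x (pscale c y) = pscale c (pmult x y)"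
    by (simp_all add: pmult_def pscale_def supercommutator_bilinear ascale_mult
      distrib_left distrib_right)
  show "module.subspace pscale (pgrade i :: (('x, 'k) free_assoc \<times> ('x, 'k) free_assoc) set)"
    unfolding module.subspace_def[OF vs[folded module_iff_vector_space]] pgrade_def pscale_def
    by (auto simp: zero_prod_def free_assoc.subspace_0[OF subspace_agrade]
      free_assoc.subspace_add[OF subspace_agrade] free_assoc.subspace_scale[OF subspace_agrade])
  show "\<exists>y\<in>pgrade 0. \<exists>z\<in>pgrade 1. x = y + z"
  proof -
    have "apart 0 f + apart 1 f = f" for f :: "('x, 'k) free_assoc"
    proof (rule poly_mapping_eqI)
      show "Poly_Mapping.lookup (apart 0 f + apart 1 f) u = Poly_Mapping.lookup f u" for u
        by (cases "word_parity u") (auto simp: lookup_add lookup_apart)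
    qed
    then have "x = (apart 0 (fst x), apart 0 (snd x)) + (apart 1 (fst x), apart 1 (snd x))"
      by simp
    moreover have "(apart i (fst x), apart i (snd x)) \<in> pgrade i" for i
      by (auto simp: pgrade_def agrade_def lookup_apart)
    ultimately show ?thesis by blast
  qed
  show "pgrade 0 \<inter> pgrade 1 = {0 :: ('x, 'k) free_assoc \<times> ('x, 'k) free_assoc}"
  proof -
    have "agrade 0 \<inter> agrade 1 = {0 :: ('x, 'k) free_assoc}"
      by (auto simp: agrade_def intro!: poly_mapping_eqI)
    then show ?thesis by (auto simp: pgrade_def zero_prod_def)
  qed
  show "pmult x y \<in> pgrade (i + j)" if "x \<in> pgrade i" "y \<in> pgrade j"
    unfolding pmult_def pgrade_def
    by (intro SigmaI agrade_mult supercommutator_agrade)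
      (use that in \<open>auto simp: pgrade_def\<close>)
  show "pmult x (pmult y z) = pmult (pmult x y) z - pscale (ssign (l * j)) (pmult (pmult x z) y)"
    if "x \<in> pgrade i" "y \<in> pgrade j" "z \<in> pgrade l"
  proof -
    have "snd x \<in> agrade i" "snd y \<in> agrade j" "snd z \<in> agrade l"
      using that by (auto simp: pgrade_def)
    note h = supercommutator_leibniz[OF this] supercommutator_homogeneous[OF this(2,3)]
    \<comment> \<open>First component: the supercommutator acting from the right is expanded. The
      second component is \<open>supercommutator_leibniz\<close>.\<close>
    have "fst x * supercommutator (snd y) (snd z) =
        fst x * snd y * snd z - ascale (ssign (l * j)) (fst x * snd z * snd y)"
      unfolding h(2) by (simp only: right_diff_distrib ascale_mult mult.assoc ssign_commute)
    then show ?thesis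
      unfolding pmult_def pscale_def by (simp only: h(1) fst_conv snd_conv diff_Pair)
  qed
qed

lemma ex_free_assoc_linear:
  "\<exists>\<Phi> :: ('x::super_set, 'k::field) lbs \<Rightarrow> ('x, 'k) free_assoc.
    Vector_Spaces.linear lscale ascale \<Phi> \<and>
    (\<forall>w. w \<noteq> [] \<longrightarrow> \<Phi> (nf w) = Poly_Mapping.single (Word w) 1)"
proof -
  let ?g = "\<lambda>x. Poly_Mapping.single (Word [x]) 1 :: ('x, 'k) free_assoc"
  have g: "(?g x, ?g x) \<in> pgrade (parity x)" for x
    by (simp add: pgrade_def agrade_def lookup_single when_def word_parity_def)
  obtain h :: "('x, 'k) lbs \<Rightarrow> ('x, 'k) free_assoc \<times> ('x, 'k) free_assoc"
    where h: "superalgebra_hom lscale (*) lgrade pscale pmult pgrade h"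
      and gen: "\<And>x. h (gen x) = (?g x, ?g x)"
    using ex1_implies_ex[OF lbs_universal[OF leibniz_superalgebra_pmult, of "\<lambda>x. (?g x, ?g x)", OF g]]
    by blast
  interpret h: Vector_Spaces.linear lscale pscale h
    using h by (simp add: superalgebra_hom_def)
  have mult: "h (f * g) = pmult (h f) (h g)" for f g
    using h by (simp add: superalgebra_hom_def)
  \<comment> \<open>Right multiplication by the image of \<open>x\<close> appends \<open>x\<close>
    to the first component, whatever the second component is; so the supercommutators never have to
    be computed.\<close>
  have "fst (h (nf w)) = Poly_Mapping.single (Word w) 1" if "w \<noteq> []" for w
    using that
  proof (induction w rule: rev_nonempty_induct)
    case (single x)
    then show ?case by (simp add: nf_def left_normed_def gen)
  next
    case (snoc x w)
    then have "nf (w @ [x]) = (nf w * gen x :: ('x, 'k) lbs)"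
      by (cases w) (simp_all add: nf_def left_normed_def)
    with snoc show ?case
      by (simp add: mult pmult_def gen mult_single plus_free_monoid_def)
  qed
  moreover have "Vector_Spaces.linear lscale ascale (\<lambda>f. fst (h f))"
    by standard (simp_all add: h.add h.scale pscale_def)
  ultimately show ?thesis by blast
qed

section \<open>Independence of the left-normed words\<close>

definition free_assoc_image :: "('x::super_set, 'k::field) lbs \<Rightarrow> ('x, 'k) free_assoc"
  where "free_assoc_image = (SOME \<Phi>. Vector_Spaces.linear lscale ascale \<Phi> \<and>
    (\<forall>w. w \<noteq> [] \<longrightarrow> \<Phi> (nf w) = Poly_Mapping.single (Word w) 1))"

lemma linear_free_assoc_image: "Vector_Spaces.linear lscale ascale free_assoc_image"
  and free_assoc_image_nf: "w \<noteq> [] \<Longrightarrow> free_assoc_image (nf w) = Poly_Mapping.single (Word w) 1"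
  using someI_ex[OF ex_free_assoc_linear] unfolding free_assoc_image_def by blast+

lemma inj_on_nf: "inj_on (nf :: _ \<Rightarrow> ('x::super_set, 'k::field) lbs) {w. w \<noteq> []}"
proof (rule inj_onI)
  fix u v :: "'x list"
  assume "u \<in> {w. w \<noteq> []}" "v \<in> {w. w \<noteq> []}" "nf u = (nf v :: ('x, 'k) lbs)"
  then have "Poly_Mapping.single (Word u) 1 = (Poly_Mapping.single (Word v) 1 :: ('x, 'k) free_assoc)"
    by (metis CollectD free_assoc_image_nf)
  then show "u = v"
    by (metis free_monoid.inject lookup_single_eq lookup_single_not_eq zero_neq_one)
qed

lemma nf_eq_iff [simp]:
  "u \<noteq> [] \<Longrightarrow> v \<noteq> [] \<Longrightarrow> (nf u :: ('x::super_set, 'k::field) lbs) = nf v \<longleftrightarrow> u = v"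
  using inj_on_nf[where 'x='x and 'k='k] by (auto simp: inj_on_def)

lemma word_of_nf [simp]: "w \<noteq> [] \<Longrightarrow> word_of (nf w :: ('x::super_set, 'k::field) lbs) = w"
  unfolding word_of_def using inv_into_f_f[OF inj_on_nf] by blast

lemma independent_NF: "lbs.independent (NF :: ('x::super_set, 'k::field) lbs set)"
proof -
  interpret \<Phi>: Vector_Spaces.linear lscale ascale "free_assoc_image :: ('x, 'k) lbs \<Rightarrow> _"
    by (rule linear_free_assoc_image)
  have "c \<mu> = 0"
    if T: "finite T" "T \<subseteq> NF" "(\<Sum>\<nu>\<in>T. lscale (c \<nu>) \<nu>) = 0" and \<mu>: "\<mu> \<in> T"
    for T and c :: "('x, 'k) lbs \<Rightarrow> 'k" and \<mu>
  proof -
    obtain w where w: "w \<noteq> []" "\<mu> = nf w"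
      using T(2) \<mu> by (auto simp: NF_def)
    \<comment> \<open>The coefficient of \<open>w\<close> in the image is a linear functional on the
      algebra. It is 1 at \<open>nf w\<close> and 0 at every other word, so it extracts one
      coefficient from a vanishing combination.\<close>
    let ?l = "\<lambda>f. Poly_Mapping.lookup f (Word w) :: 'k"
    have "?l (free_assoc_image \<nu>) = (if \<nu> = \<mu> then 1 else 0)" if "\<nu> \<in> T" for \<nu>
      using that T(2) w by (auto simp: NF_def free_assoc_image_nf lookup_single when_def)
    then have "(\<Sum>\<nu>\<in>T. c \<nu> * ?l (free_assoc_image \<nu>)) = c \<mu>"
      using T(1) \<mu> by (simp add: if_distrib[of "(*) _"] cong: if_cong)
    moreover have "(\<Sum>\<nu>\<in>T. c \<nu> * ?l (free_assoc_image \<nu>)) =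
        ?l (free_assoc_image (\<Sum>\<nu>\<in>T. lscale (c \<nu>) \<nu>))"
      by (simp add: \<Phi>.sum \<Phi>.scale lookup_sum lookup_ascale)
    ultimately show ?thesis
      using T(3) by (simp add: \<Phi>.zero)
  qed
  then show ?thesis
    unfolding lbs.independent_explicit_module by blast
qed

section \<open>Products of left-normed words\<close>

text \<open>All normal polynomials and Leibniz expansions are written with this operation; it may
  start from any element, whereas \<open>nf\<close> starts from a letter.\<close>

definition rmul :: "('x::super_set, 'k::field) lbs \<Rightarrow> 'x list \<Rightarrow> ('x, 'k) lbs"
  where "rmul f w = foldl (*) f (map gen w)"

lemma rmul_simps [simp]:
  "rmul f [] = f" "rmul f (x # w) = rmul (f * gen x) w" "rmul f (u @ v) = rmul (rmul f u) v"
  by (simp_all add: rmul_def)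

lemma nf_singleton [simp]: "nf [x] = gen x"
  by (simp add: nf_def left_normed_def)

lemma rmul_nf: "u \<noteq> [] \<Longrightarrow> rmul (nf u) v = nf (u @ v)"
  by (cases u) (simp_all add: rmul_def nf_def left_normed_def)

lemma nf_mult_gen: "u \<noteq> [] \<Longrightarrow> nf u * gen x = nf (u @ [x])"
  using rmul_nf[of u "[x]"] by simp

lemma linear_mult_left: "Vector_Spaces.linear lscale lscale (\<lambda>g. f * g)"
  by standard (simp_all add: lbs.mult_add_right lbs.mult_scale_right)

lemma linear_mult_right: "Vector_Spaces.linear lscale lscale (\<lambda>f. f * g)"
  by standard (simp_all add: lbs.mult_add_left lbs.mult_scale_left)

lemma linear_rmul: "Vector_Spaces.linear lscale lscale (\<lambda>f. rmul f w)"
proof -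
  have "rmul (f + g) w = rmul f w + rmul g w" "rmul (lscale c f) w = lscale c (rmul f w)" for f g c
    by (induction w arbitrary: f g) (simp_all add: lbs.mult_add_left lbs.mult_scale_left)
  then show ?thesis by unfold_locales
qed

lemma linear_span_subset:
  assumes "Vector_Spaces.linear lscale lscale \<phi>" "lbs.subspace V" "\<And>a. a \<in> A \<Longrightarrow> \<phi> a \<in> V"
    and "f \<in> lbs.span A"
  shows "\<phi> f \<in> V"
proof -
  interpret \<phi>: Vector_Spaces.linear lscale lscale \<phi> by fact
  have "lbs.span A \<subseteq> \<phi> -` V"
    by (rule lbs.span_minimal) (use assms(2,3) \<phi>.subspace_vimage in auto)
  with assms(4) show ?thesis by blast
qed

lemma nf_grade: "w \<noteq> [] \<Longrightarrow> nf w \<in> lgrade (\<Sum>a\<leftarrow>w. parity a)"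
proof (induction w rule: rev_nonempty_induct)
  case (single x)
  show ?case using gen_grade[of x] by (simp only: nf_singleton list.map sum_list.Cons sum_list.Nil add_0_right)
next
  case (snoc x w)
  then show ?case
    using lbs.mult_grade[OF snoc.IH gen_grade[of x]] by (simp add: nf_mult_gen)
qed

text \<open>The sign depends only on the parities of \<open>y\<close> and \<open>z\<close>, so the
  identity extends linearly from the homogeneous components of \<open>x\<close>.\<close>

lemma leibniz_any:
  assumes "y \<in> lgrade j" "z \<in> lgrade l"
  shows "x * (y * z) = x * y * z - lscale (ssign (l * j)) (x * z * y)"
proof -
  obtain u v where "u \<in> lgrade 0" "v \<in> lgrade 1" "x = u + v"
    using lbs.grade_decomp by blast
  then show ?thesis
    using lbs.leibniz[OF _ assms, of u] lbs.leibniz[OF _ assms, of v]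
    by (simp add: lbs.mult_add_left lbs.scale_right_distrib)
qed

text \<open>The Leibniz identity rewrites \<open>f * (nf w * gen x)\<close> through
  \<open>(f * nf w) * gen x\<close> and \<open>(f * gen x) * nf w\<close>; the second product is why
  the induction is for arbitrary \<open>f\<close>. The multiset of letters is recorded because it
  determines the degree.\<close>

lemma mult_nf_right:
  assumes "v \<noteq> []"
  shows "f * nf v \<in> lbs.span {rmul f v' | v'. mset v' = mset v}"
  using assms
proof (induction v arbitrary: f rule: rev_nonempty_induct)
  case (single x)
  have "f * nf [x] = rmul f [x]" by simp
  then show ?case by (intro lbs.span_base) blast
next
  case (snoc x w)
  let ?V = "lbs.span {rmul f v' | v'. mset v' = mset (w @ [x])}"
  have "f * nf w * gen x \<in> ?V"
  proof (rule linear_span_subset[OF linear_mult_right _ _ snoc.IH[of f]])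
    fix a assume "a \<in> {rmul f v' |v'. mset v' = mset w}"
    then obtain v' where "mset v' = mset w" "a * gen x = rmul f (v' @ [x])" by auto
    then show "a * gen x \<in> ?V" by (intro lbs.span_base CollectI exI[of _ "v' @ [x]"]) simp
  qed simp
  moreover have "f * gen x * nf w \<in> ?V"
  proof (rule set_mp[OF lbs.span_mono snoc.IH])
    have "\<exists>v''. rmul (f * gen x) v' = rmul f v'' \<and> mset v'' = mset (w @ [x])"
      if "mset v' = mset w" for v'
      using that by (intro exI[of _ "x # v'"]) simp
    then show "{rmul (f * gen x) v' |v'. mset v' = mset w} \<subseteq> {rmul f v' |v'. mset v' = mset (w @ [x])}"
      by blast
  qed
  moreover have "f * nf (w @ [x]) = f * nf w * gen x
      - lscale (ssign (parity x * (\<Sum>a\<leftarrow>w. parity a))) (f * gen x * nf w)"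
    unfolding nf_mult_gen[OF snoc.hyps, symmetric]
    by (rule leibniz_any[OF nf_grade[OF snoc.hyps] gen_grade])
  ultimately show ?case
    by (simp add: lbs.span_diff lbs.span_scale)
qed

lemma nf_mult_nf:
  assumes "u \<noteq> []" "v \<noteq> []"
  shows "nf u * nf v \<in> lbs.span {nf (u @ v') | v'. mset v' = mset v}"
  using mult_nf_right[OF assms(2), of "nf u"] by (simp add: rmul_nf[OF assms(1)])

lemma span_NF: "lbs.span NF = (UNIV :: ('x::super_set, 'k::field) lbs set)"
proof -
  \<comment> \<open>By bilinearity it suffices to multiply two words, which
    \<open>nf_mult_nf\<close> expands. The span thus contains the generators and is closed under
    products, so it contains every nonassociative monomial.\<close>
  have mult: "f * g \<in> lbs.span NF" if "f \<in> lbs.span NF" "g \<in> lbs.span NF" for f g :: "('x, 'k) lbs"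
  proof (rule linear_span_subset[OF linear_mult_left _ _ that(2)])
    fix \<nu> :: "('x, 'k) lbs" assume "\<nu> \<in> NF"
    then obtain v where v: "v \<noteq> []" "\<nu> = nf v" by (auto simp: NF_def)
    show "f * \<nu> \<in> lbs.span NF"
    proof (rule linear_span_subset[OF linear_mult_right _ _ that(1)])
      fix \<mu> :: "('x, 'k) lbs" assume "\<mu> \<in> NF"
      then obtain u where u: "u \<noteq> []" "\<mu> = nf u" by (auto simp: NF_def)
      have "{nf (u @ v') | v'. mset v' = mset v} \<subseteq> NF"
        using u(1) by (auto simp: NF_def)
      then show "\<mu> * \<nu> \<in> lbs.span NF"
        using nf_mult_nf[OF u(1) v(1)] u v lbs.span_mono by blast
    qed simp
  qed simp
  have single: "abs_lbs (Poly_Mapping.single m 1) \<in> lbs.span (NF :: ('x, 'k) lbs set)" for m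
  proof (induction m)
    case (Gen x)
    have "gen x = (nf [x] :: ('x, 'k) lbs)" by simp
    then have "gen x \<in> (NF :: ('x, 'k) lbs set)" unfolding NF_def by blast
    then show ?case by (simp add: gen.abs_eq lbs.span_base)
  next
    case (Node u v)
    then show ?case
      using mult[OF Node] by (simp add: fmult_single abs_lbs_hom)
  qed
  have "abs_lbs f \<in> lbs.span (NF :: ('x, 'k) lbs set)" for f
  proof (induction f rule: update_induct)
    case const
    then show ?case by (simp add: abs_lbs_hom(5) lbs.span_zero)
  next
    case (update f m c)
    have "Poly_Mapping.update m c f = f + fscale c (Poly_Mapping.single m 1)"
      by (rule poly_mapping_eqI)
        (use update(1) in \<open>auto simp: lookup_update lookup_add lookup_single in_keys_iff when_def\<close>)
    then have "abs_lbs (Poly_Mapping.update m c f) =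
        abs_lbs f + lscale c (abs_lbs (Poly_Mapping.single m 1))"
      by (simp only: abs_lbs_hom)
    then show ?case
      using update.IH single by (simp add: lbs.span_add lbs.span_scale)
  qed
  then show ?thesis using abs_lbs_surj by (metis UNIV_eq_I)
qed

section \<open>Leading words\<close>

definition word_deg :: "('x \<Rightarrow> nat) \<Rightarrow> 'x list \<Rightarrow> nat"
  where "word_deg deg w = (\<Sum>a\<leftarrow>w. deg a)"

lemma word_deg_simps [simp]:
  "word_deg deg [] = 0" "word_deg deg (x # w) = deg x + word_deg deg w"
  "word_deg deg (u @ v) = word_deg deg u + word_deg deg v"
  by (simp_all add: word_deg_def)

lemma word_deg_cong_mset: "mset u = mset v \<Longrightarrow> word_deg deg u = word_deg deg v"
  unfolding word_deg_def by (metis mset_map sum_mset_sum_list)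

text \<open>\<open>lenlex\<close> merges the comparison of lengths with that of letters. Working on
  words instead of elements of \<open>NF\<close> avoids the inverse function in
  \<open>word_of\<close>.\<close>

definition word_less :: "('x::wellorder \<Rightarrow> nat) \<Rightarrow> 'x list \<Rightarrow> 'x list \<Rightarrow> bool"
  where "word_less deg u v \<longleftrightarrow> word_deg deg u < word_deg deg v \<or>
    word_deg deg u = word_deg deg v \<and> (u, v) \<in> lenlex {(a, b). a < b}"

abbreviation word_le :: "('x::wellorder \<Rightarrow> nat) \<Rightarrow> 'x list \<Rightarrow> 'x list \<Rightarrow> bool"
  where "word_le deg u v \<equiv> u = v \<or> word_less deg u v"

lemma nf_less_nf:
  "u \<noteq> [] \<Longrightarrow> v \<noteq> [] \<Longrightarrow>
    nf_less deg (nf u :: ('x::{super_set,wellorder}, 'k::field) lbs) (nf v) \<longleftrightarrow> word_less deg u v"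
  by (auto simp: nf_less_def wt_def nf_deg_def nf_length_def word_less_def word_deg_def lenlex_def)

lemma wf_word_less: "wf {(u, v). word_less deg u v}"
proof -
  have "{(u, v). word_less deg u v} =
      inv_image (less_than <*lex*> lenlex {(a, b). a < b}) (\<lambda>u. (word_deg deg u, u))"
    by (auto simp: word_less_def)
  then show ?thesis by (simp add: wf_lenlex wf_lex_prod wf)
qed

lemma word_less_irrefl [simp]: "\<not> word_less deg u u"
  using wf_not_refl[OF wf_word_less] by fastforce

lemma word_less_trans [trans]:
  assumes "word_less deg u v" "word_less deg v w"
  shows "word_less deg u w"
proof -
  have "trans {(a, b). a < (b :: 'a)}" by (auto intro!: transI)
  then show ?thesis
    using assms lenlex_trans[of u v "{(a, b). a < b}" w] by (auto simp: word_less_def)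
qed

lemma word_less_total: "word_less deg u v \<or> u = v \<or> word_less deg v u"
proof -
  have "total {(a, b). a < (b :: 'a)}" by (auto simp: total_on_def)
  from total_lenlex[OF this] show ?thesis
    by (auto simp: word_less_def total_on_def)
qed

lemma word_less_append_right: "word_less deg u v \<Longrightarrow> word_less deg (u @ w) (v @ w)"
  by (auto simp: word_less_def lenlex_append1)

lemma word_less_append_left: "word_less deg u v \<Longrightarrow> word_less deg (w @ u) (w @ v)"
proof -
  have "irrefl {(a, b). a < (b :: 'a)}" by (auto simp: irrefl_def)
  then show "word_less deg u v \<Longrightarrow> word_less deg (w @ u) (w @ v)"
    by (auto simp: word_less_def)
qed

text \<open>At equal degree a smaller word is at most as long. This dichotomy drives all estimates
  for one-letter leading words: a smaller letter takes the place of the old one, and a drop in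
  degree survives any permutation of letters.\<close>

lemma word_less_singleton:
  assumes "v \<noteq> []" "word_less deg v [x]"
  shows "word_deg deg v < deg x \<or> (\<exists>y. v = [y])"
proof (cases "word_deg deg v < deg x")
  case False
  with assms(2) have "(v, [x]) \<in> lenlex {(a, b). a < b}" by (simp add: word_less_def)
  then have "length v \<le> 1" using lenlex_length by fastforce
  with assms(1) show ?thesis by (cases v) auto
qed simp

section \<open>Coefficients and spans of words\<close>

lemma coeff_add: "coeff (f + g) \<mu> = coeff f \<mu> + coeff g \<mu>"
  by (simp add: coeff_def lbs.representation_add independent_NF span_NF)

lemma coeff_diff: "coeff (f - g) \<mu> = coeff f \<mu> - coeff g \<mu>"
  by (simp add: coeff_def lbs.representation_diff independent_NF span_NF)

lemma coeff_scale: "coeff (lscale c f) \<mu> = c * coeff f \<mu>"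
  by (simp add: coeff_def lbs.representation_scale independent_NF span_NF)

lemma coeff_zero: "coeff 0 \<mu> = 0"
  by (simp add: coeff_def lbs.representation_zero)

lemma coeff_nf:
  "u \<noteq> [] \<Longrightarrow> v \<noteq> [] \<Longrightarrow>
    coeff (nf u :: ('x::super_set, 'k::field) lbs) (nf v) = (if u = v then 1 else 0)"
proof -
  assume *: "u \<noteq> []" "v \<noteq> []"
  then have "nf u \<in> (NF :: ('x, 'k) lbs set)" by (simp add: NF_def)
  with * show ?thesis by (auto simp: coeff_def lbs.representation_basis independent_NF)
qed

definition nf_span :: "('x::super_set list \<Rightarrow> bool) \<Rightarrow> ('x, 'k::field) lbs set"
  where "nf_span Q = lbs.span (nf ` {w. w \<noteq> [] \<and> Q w})"

lemma nf_spanI: "w \<noteq> [] \<Longrightarrow> Q w \<Longrightarrow> nf w \<in> nf_span Q"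
  unfolding nf_span_def by (rule lbs.span_base) blast

lemma subspace_nf_span: "lbs.subspace (nf_span Q)"
  by (simp add: nf_span_def)

text \<open>The condition on coefficients cuts out a subspace that contains the spanning words;
  conversely an element is the sum of its terms in the basis. Bounds on the words that occur can
  then be checked coefficientwise.\<close>

lemma nf_span_iff:
  fixes f :: "('x::super_set, 'k::field) lbs"
  shows "f \<in> nf_span Q \<longleftrightarrow> (\<forall>w. w \<noteq> [] \<longrightarrow> coeff f (nf w) \<noteq> 0 \<longrightarrow> Q w)"
proof
  let ?V = "{f :: ('x, 'k) lbs. \<forall>w. w \<noteq> [] \<longrightarrow> coeff f (nf w) \<noteq> 0 \<longrightarrow> Q w}"
  have "lbs.subspace ?V"
  proof (rule lbs.subspaceI)
    fix x y assume xy: "x \<in> ?V" "y \<in> ?V"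
    have "coeff x (nf w) \<noteq> 0 \<or> coeff y (nf w) \<noteq> 0" if "coeff (x + y) (nf w) \<noteq> 0" for w
      using that by (auto simp: coeff_add)
    with xy show "x + y \<in> ?V" by blast
  qed (auto simp: coeff_zero coeff_scale)
  then have "nf_span Q \<subseteq> ?V"
    unfolding nf_span_def
    by (rule lbs.span_minimal[rotated]) (auto simp: coeff_nf split: if_splits)
  then show "f \<in> nf_span Q \<Longrightarrow> \<forall>w. w \<noteq> [] \<longrightarrow> coeff f (nf w) \<noteq> 0 \<longrightarrow> Q w" by blast
next
  assume *: "\<forall>w. w \<noteq> [] \<longrightarrow> coeff f (nf w) \<noteq> 0 \<longrightarrow> Q w"
  have "(\<Sum>\<mu> | coeff f \<mu> \<noteq> 0. lscale (coeff f \<mu>) \<mu>) \<in> nf_span Q"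
  proof (intro lbs.subspace_sum lbs.subspace_scale subspace_nf_span)
    fix \<mu> assume \<mu>: "\<mu> \<in> {\<mu>. coeff f \<mu> \<noteq> 0}"
    then have "\<mu> \<in> NF" using lbs.representation_ne_zero by (auto simp: coeff_def)
    with \<mu> * show "\<mu> \<in> nf_span Q" by (auto simp: NF_def intro: nf_spanI)
  qed
  then show "f \<in> nf_span Q"
    using lbs.sum_nonzero_representation_eq[OF independent_NF, of f]
    by (simp add: coeff_def span_NF)
qed

lemma nf_span_mono:
  "f \<in> nf_span Q \<Longrightarrow> (\<And>w. w \<noteq> [] \<Longrightarrow> Q w \<Longrightarrow> Q' w) \<Longrightarrow> f \<in> nf_span Q'"
  by (auto simp: nf_span_iff)

lemma finite_coeff_support:
  fixes f :: "('x::super_set, 'k::field) lbs"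
  shows "finite {w. w \<noteq> [] \<and> coeff f (nf w) \<noteq> 0}"
proof (rule finite_imageD)
  show "finite ((nf :: _ \<Rightarrow> ('x, 'k) lbs) ` {w. w \<noteq> [] \<and> coeff f (nf w) \<noteq> 0})"
    by (rule finite_subset[OF _ lbs.finite_representation[of NF f]]) (auto simp: coeff_def)
  show "inj_on (nf :: _ \<Rightarrow> ('x, 'k) lbs) {w. w \<noteq> [] \<and> coeff f (nf w) \<noteq> 0}"
    by (rule inj_on_subset[OF inj_on_nf]) blast
qed

section \<open>Leading words and monic elements\<close>

lemma finite_word_le_max:
  "finite A \<Longrightarrow> A \<noteq> {} \<Longrightarrow> \<exists>m\<in>A. \<forall>v\<in>A. word_le deg v m"
proof (induction A rule: finite_ne_induct)
  case (insert u A)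
  then obtain m where m: "m \<in> A" "\<forall>v\<in>A. word_le deg v m" by blast
  show ?case
  proof (cases "word_less deg m u")
    case True
    then have "word_le deg v u" if "v \<in> A" for v
      using that m(2) word_less_trans[of deg v m u] by auto
    then show ?thesis by blast
  next
    case False
    then have "word_le deg u m" using word_less_total[of deg u m] by blast
    with m show ?thesis by blast
  qed
qed simp

lemma lead_eqI:
  assumes "w \<noteq> []" "coeff f (nf w) \<noteq> 0" "f \<in> nf_span (\<lambda>v. word_le deg v w)"
  shows "lead deg f = nf w"
  unfolding lead_def
proof (rule the_equality)
  have m: "monomials f = nf ` {v. v \<noteq> [] \<and> coeff f (nf v) \<noteq> 0}"
    by (auto simp: monomials_def NF_def)
  show *: "nf w \<in> monomials f \<and> (\<forall>\<nu>\<in>monomials f. \<nu> \<noteq> nf w \<longrightarrow> nf_less deg \<nu> (nf w))"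
    using assms by (auto simp: m nf_less_nf nf_span_iff)
  fix \<mu> assume \<mu>: "\<mu> \<in> monomials f \<and> (\<forall>\<nu>\<in>monomials f. \<nu> \<noteq> \<mu> \<longrightarrow> nf_less deg \<nu> \<mu>)"
  then obtain u where u: "u \<noteq> []" "\<mu> = nf u" by (auto simp: m)
  show "\<mu> = nf w"
  proof (rule ccontr)
    assume "\<mu> \<noteq> nf w"
    then have "nf_less deg (nf w) \<mu>" "nf_less deg \<mu> (nf w)" using * \<mu> by auto
    then show False
      using u assms(1) word_less_trans[of deg u w u] by (simp add: nf_less_nf)
  qed
qed

lemma ex_lead_word:
  assumes "f \<noteq> 0"
  obtains w where "w \<noteq> []" "coeff f (nf w) \<noteq> 0" "f \<in> nf_span (\<lambda>v. word_le deg v w)"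
    "lead deg f = nf w" "f - lscale (coeff f (nf w)) (nf w) \<in> nf_span (\<lambda>v. word_less deg v w)"
proof -
  let ?A = "{w. w \<noteq> [] \<and> coeff f (nf w) \<noteq> 0}"
  have "?A \<noteq> {}"
  proof
    assume "?A = {}"
    then have "f \<in> nf_span (\<lambda>_. False)" by (auto simp: nf_span_iff)
    with assms show False by (simp add: nf_span_def)
  qed
  from finite_word_le_max[OF finite_coeff_support this] obtain w
    where w: "w \<in> ?A" "\<forall>v\<in>?A. word_le deg v w" by blast
  then have "f \<in> nf_span (\<lambda>v. word_le deg v w)"
    "f - lscale (coeff f (nf w)) (nf w) \<in> nf_span (\<lambda>v. word_less deg v w)"
    by (auto simp: nf_span_iff coeff_diff coeff_scale coeff_nf split: if_splits)
  with w that lead_eqI show thesis by blast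
qed

text \<open>Holds the leading word and the leading coefficient 1 in one predicate without the
  definite description in \<open>lead\<close>. The form with a smaller remainder is convenient for
  linear maps.\<close>

definition monic_at :: "('x::{super_set,wellorder} \<Rightarrow> nat) \<Rightarrow> ('x, 'k::field) lbs \<Rightarrow> 'x list \<Rightarrow> bool"
  where "monic_at deg f w \<longleftrightarrow> w \<noteq> [] \<and> f - nf w \<in> nf_span (\<lambda>v. word_less deg v w)"

lemma monic_at_iff:
  "monic_at deg f w \<longleftrightarrow> w \<noteq> [] \<and> coeff f (nf w) = 1 \<and> f \<in> nf_span (\<lambda>v. word_le deg v w)"
proof (cases "w = []")
  case False
  show ?thesis
  proof
    assume "monic_at deg f w"
    then have *: "v \<noteq> [] \<Longrightarrow> coeff f (nf v) \<noteq> coeff (nf w) (nf v) \<Longrightarrow> word_less deg v w" for v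
      by (auto simp: monic_at_def nf_span_iff coeff_diff)
    have "coeff f (nf w) = 1"
      using *[of w] False by (auto simp: coeff_nf)
    moreover have "f \<in> nf_span (\<lambda>v. word_le deg v w)"
      using * False by (fastforce simp: nf_span_iff coeff_nf)
    ultimately show "w \<noteq> [] \<and> coeff f (nf w) = 1 \<and> f \<in> nf_span (\<lambda>v. word_le deg v w)"
      using False by blast
  qed (auto simp: monic_at_def nf_span_iff coeff_diff coeff_nf split: if_splits)
qed (simp add: monic_at_def)

lemma monic_at_nonempty: "monic_at deg f w \<Longrightarrow> w \<noteq> []"
  by (simp add: monic_at_def)

lemma lead_monic_at: "monic_at deg f w \<Longrightarrow> lead deg f = nf w"
  by (rule lead_eqI) (auto simp: monic_at_iff)

lemma monic_at_unique: "monic_at deg f u \<Longrightarrow> monic_at deg f v \<Longrightarrow> u = v"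
  using lead_monic_at monic_at_nonempty by (metis nf_eq_iff)

lemma monic_imp_monic_at:
  assumes "monic deg f"
  shows "\<exists>w. monic_at deg f w"
proof -
  from assms have "f \<noteq> 0" by (simp add: monic_def)
  then obtain w where "w \<noteq> []" "f \<in> nf_span (\<lambda>v. word_le deg v w)" "lead deg f = nf w"
    by (rule ex_lead_word)
  with assms show ?thesis by (auto simp: monic_at_iff monic_def)
qed

text \<open>Passes from parities of monomials to the grading of the superalgebra, in which the
  Leibniz identity is stated.\<close>

lemma homogeneous_imp_grade:
  assumes "homogeneous f"
  shows "\<exists>i. f \<in> lgrade i"
proof -
  obtain i where "\<forall>\<mu>\<in>monomials f. nf_parity \<mu> = i"
    using assms by (auto simp: homogeneous_def)
  then have "f \<in> nf_span (\<lambda>w. (\<Sum>a\<leftarrow>w. parity a) = i)"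
    by (auto simp: nf_span_iff monomials_def nf_parity_def NF_def)
  moreover have "nf_span (\<lambda>w. (\<Sum>a\<leftarrow>w. parity a) = i) \<subseteq> lgrade i"
    unfolding nf_span_def by (rule lbs.span_minimal) (use nf_grade lbs.subspace_grade in auto)
  ultimately show ?thesis by blast
qed

lemma nf_span_rmul:
  assumes "f \<in> nf_span (\<lambda>v. word_less deg v w)"
  shows "rmul f a \<in> nf_span (\<lambda>v. word_less deg v (w @ a))"
  by (rule linear_span_subset[OF linear_rmul subspace_nf_span _ assms[unfolded nf_span_def]])
    (auto simp: rmul_nf intro!: nf_spanI word_less_append_right)

lemma monic_at_rmul:
  assumes "monic_at deg f w"
  shows "monic_at deg (rmul f a) (w @ a)"
proof -
  interpret R: Vector_Spaces.linear lscale lscale "\<lambda>f. rmul f a" by (rule linear_rmul)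
  have "rmul f a - nf (w @ a) = rmul (f - nf w) a"
    using assms by (simp add: R.diff rmul_nf monic_at_def)
  then show ?thesis
    using assms nf_span_rmul by (auto simp: monic_at_def)
qed

text \<open>Among the lower terms of \<open>f\<close>, smaller letters are appended to
  \<open>a\<close> and stay smaller, while words of smaller degree may be permuted by the Leibniz
  expansion but keep their degree. For longer leading words this fails: for even \<open>x\<close>
  the product of a letter with \<open>gen x * gen x\<close> is zero.\<close>

lemma monic_at_nf_mult:
  assumes "monic_at deg f [x]" "a \<noteq> []"
  shows "monic_at deg (nf a * f) (a @ [x])"
proof -
  have "f - gen x \<in> lbs.span (nf ` {v. v \<noteq> [] \<and> word_less deg v [x]})"
    using assms(1) by (simp add: monic_at_def nf_span_def)
  then have "nf a * (f - gen x) \<in> nf_span (\<lambda>v. word_less deg v (a @ [x]))"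
  proof (rule linear_span_subset[OF linear_mult_left subspace_nf_span, rotated])
    fix \<nu> assume "\<nu> \<in> nf ` {v. v \<noteq> [] \<and> word_less deg v [x]}"
    then obtain v where v: "v \<noteq> []" "word_less deg v [x]" "\<nu> = nf v" by blast
    then consider y where "v = [y]" | "word_deg deg v < deg x"
      using word_less_singleton by blast
    then show "nf a * \<nu> \<in> nf_span (\<lambda>v. word_less deg v (a @ [x]))"
    proof cases
      case 1
      then show ?thesis
        using v assms(2) by (auto simp: nf_mult_gen intro!: nf_spanI word_less_append_left)
    next
      case 2
      have "nf (a @ v') \<in> nf_span (\<lambda>v. word_less deg v (a @ [x]))" if "mset v' = mset v" for v'
        using that assms(2) 2
        by (intro nf_spanI) (auto simp: word_less_def word_deg_cong_mset[OF that])
      then have "lbs.span {nf (a @ v') |v'. mset v' = mset v} \<subseteq> nf_span (\<lambda>v. word_less deg v (a @ [x]))"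
        by (intro lbs.span_minimal subspace_nf_span) blast
      then show ?thesis using nf_mult_nf[OF assms(2) v(1)] v(3) by blast
    qed
  qed
  then show ?thesis
    using assms(2) by (simp add: monic_at_def lbs.mult_diff_right nf_mult_gen)
qed

section \<open>Normal polynomials\<close>

lemma rmul_grade:
  assumes "f \<in> lgrade i"
  shows "\<exists>j. rmul f a \<in> lgrade j"
  using assms
proof (induction a arbitrary: f i)
  case (Cons x a)
  show ?case using Cons.IH[OF lbs.mult_grade[OF Cons.prems gen_grade]] by simp
qed auto

locale monic_homogeneous_set =
  fixes deg :: "'x::{super_set,wellorder} \<Rightarrow> nat"
    and S :: "('x, 'k::field) lbs set"
  assumes monic_S: "s \<in> S \<Longrightarrow> monic deg s"
    and homogeneous_S: "s \<in> S \<Longrightarrow> homogeneous s"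
begin

text \<open>The second argument is the leading word of the normal polynomial.\<close>

inductive normal :: "('x, 'k) lbs \<Rightarrow> 'x list \<Rightarrow> bool" where
  prefix: "s \<in> S \<Longrightarrow> monic_at deg s u \<Longrightarrow> normal (rmul s a) (u @ a)"
| inner: "s \<in> S \<Longrightarrow> monic_at deg s [x] \<Longrightarrow> a \<noteq> [] \<Longrightarrow> normal (rmul (nf a * s) b) (a @ x # b)"

lemma normal_S: "s \<in> S \<Longrightarrow> monic_at deg s u \<Longrightarrow> normal s u"
  using prefix[of s u "[]"] by simp

lemma normal_nf_mult: "s \<in> S \<Longrightarrow> monic_at deg s [x] \<Longrightarrow> a \<noteq> [] \<Longrightarrow> normal (nf a * s) (a @ [x])"
  using inner[of s x a "[]"] by simp

lemma normal_monic_at: "normal h w \<Longrightarrow> monic_at deg h w"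
proof (induction rule: normal.induct)
  case (inner s x a b)
  then show ?case using monic_at_rmul[OF monic_at_nf_mult] by fastforce
qed (rule monic_at_rmul)

lemma normal_nonempty: "normal h w \<Longrightarrow> w \<noteq> []"
  using normal_monic_at monic_at_nonempty by blast

lemma lead_normal: "normal h w \<Longrightarrow> lead deg h = nf w"
  using normal_monic_at lead_monic_at by blast

lemma normal_rmul: "normal h w \<Longrightarrow> normal (rmul h a) (w @ a)"
proof (induction rule: normal.induct)
  case (prefix s u b)
  then show ?case using normal.prefix[of s u "b @ a"] by simp
next
  case (inner s x c b)
  then show ?case using normal.inner[of s x c "b @ a"] by simp
qed

text \<open>A leading word of one letter leaves no room for further factors. Hence such a polynomial
  can be multiplied from the left by a word and stays normal.\<close>

lemma normal_singleton:
  assumes "normal h [y]"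
  shows "h \<in> S" "monic_at deg h [y]"
proof -
  show m: "monic_at deg h [y]" using assms by (rule normal_monic_at)
  show "h \<in> S"
    using assms
  proof cases
    case (prefix s u a)
    then have "a = []" using monic_at_nonempty by (cases u) auto
    with prefix show ?thesis by simp
  next
    case (inner s x a b)
    then show ?thesis by (cases a) auto
  qed
qed

lemma ex_monic_at_S: "s \<in> S \<Longrightarrow> \<exists>u. monic_at deg s u"
  using monic_S monic_imp_monic_at by blast

lemma S_grade: "s \<in> S \<Longrightarrow> \<exists>i. s \<in> lgrade i"
  using homogeneous_S homogeneous_imp_grade by blast

lemma normal_grade: "normal h w \<Longrightarrow> \<exists>i. h \<in> lgrade i"
proof (induction rule: normal.induct)
  case (prefix s u a)
  then show ?case using S_grade rmul_grade by blast
next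
  case (inner s x a b)
  then show ?case using S_grade rmul_grade lbs.mult_grade nf_grade by blast
qed

lemma left_normed_inner:
  "a \<noteq> [] \<Longrightarrow> left_normed (map gen a @ s # map gen b) = rmul (nf a * s) b"
  by (cases a) (simp_all add: left_normed_def rmul_def nf_def)

lemma nf_length_lead: "monic_at deg s u \<Longrightarrow> nf_length (lead deg s) = length u"
  by (simp add: lead_monic_at nf_length_def monic_at_nonempty)

lemma normal_polys_of_prefix: "rmul s a \<in> normal_polys_of deg s"
  by (auto simp: normal_polys_of_def left_normed_def rmul_def)

lemma normal_polys_of_inner:
  assumes "monic_at deg s [x]" "a \<noteq> []"
  shows "rmul (nf a * s) b \<in> normal_polys_of deg s"
proof -
  have "nf_length (lead deg s) = 1" using nf_length_lead[OF assms(1)] by simp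
  then show ?thesis
    unfolding normal_polys_of_def left_normed_inner[OF assms(2), symmetric] using assms(2) by blast
qed

lemma normal_polys_of_normal:
  assumes "s \<in> S" "h \<in> normal_polys_of deg s"
  shows "\<exists>w. normal h w"
proof -
  obtain u where u: "monic_at deg s u" using ex_monic_at_S[OF assms(1)] by blast
  consider a where "h = rmul s a"
    | a b where "h = rmul (nf a * s) b" "a \<noteq> []" "nf_length (lead deg s) = 1"
    using assms(2) unfolding normal_polys_of_def
    by (auto simp: left_normed_inner) (simp add: left_normed_def rmul_def)
  then show ?thesis
  proof cases
    case 1
    then show ?thesis using prefix[OF assms(1) u] by blast
  next
    case 2
    then obtain x where "u = [x]"
      using nf_length_lead[OF u] by (cases u) auto
    then show ?thesis using inner[OF assms(1)] u 2 by blast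
  qed
qed

lemma normal_polys_iff: "h \<in> normal_polys deg S \<longleftrightarrow> (\<exists>w. normal h w)"
proof
  assume "\<exists>w. normal h w"
  then obtain w where "normal h w" by blast
  then show "h \<in> normal_polys deg S"
    unfolding normal_polys_def
    by cases (auto intro: normal_polys_of_prefix normal_polys_of_inner)
qed (auto simp: normal_polys_def normal_polys_of_normal)

section \<open>Spans of normal polynomials with restricted leading words\<close>

definition normal_span :: "('x list \<Rightarrow> bool) \<Rightarrow> ('x, 'k) lbs set"
  where "normal_span Q = lbs.span {h. \<exists>w. normal h w \<and> Q w}"

lemma normal_spanI: "normal h w \<Longrightarrow> Q w \<Longrightarrow> h \<in> normal_span Q"
  unfolding normal_span_def by (rule lbs.span_base) blast

text \<open>Both kinds of triviality are memberships in such subspaces: \<open>Q\<close> bounds the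
  leading word strictly in one case and bounds its degree in the other.\<close>

lemma subspace_normal_span: "lbs.subspace (normal_span Q)"
  by (simp add: normal_span_def)

lemmas normal_span_zero = lbs.subspace_0[OF subspace_normal_span]
  and normal_span_add = lbs.subspace_add[OF subspace_normal_span]
  and normal_span_diff = lbs.subspace_diff[OF subspace_normal_span]
  and normal_span_neg = lbs.subspace_neg[OF subspace_normal_span]
  and normal_span_scale = lbs.subspace_scale[OF subspace_normal_span]

lemma normal_span_minimal:
  "lbs.subspace V \<Longrightarrow> (\<And>h w. normal h w \<Longrightarrow> Q w \<Longrightarrow> h \<in> V) \<Longrightarrow> normal_span Q \<subseteq> V"
  unfolding normal_span_def by (rule lbs.span_minimal) auto

lemma normal_span_linear:
  assumes "Vector_Spaces.linear lscale lscale \<phi>" "lbs.subspace V"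
    and "\<And>h w. normal h w \<Longrightarrow> Q w \<Longrightarrow> \<phi> h \<in> V"
    and "f \<in> normal_span Q"
  shows "\<phi> f \<in> V"
  using linear_span_subset[OF assms(1,2) _ assms(4)[unfolded normal_span_def]] assms(3) by blast

lemma normal_span_mono:
  "f \<in> normal_span Q \<Longrightarrow> (\<And>h w. normal h w \<Longrightarrow> Q w \<Longrightarrow> Q' w) \<Longrightarrow> f \<in> normal_span Q'"
  by (rule normal_span_linear[OF lbs.linear_ident subspace_normal_span]) (auto intro: normal_spanI)

lemma normal_span_rmul:
  "f \<in> normal_span Q \<Longrightarrow> (\<And>w. Q w \<Longrightarrow> Q' (w @ a)) \<Longrightarrow> rmul f a \<in> normal_span Q'"
  by (rule normal_span_linear[OF linear_rmul subspace_normal_span])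
    (auto intro: normal_spanI normal_rmul)

lemma normal_mult_nf:
  assumes "normal h w" "v \<noteq> []" "\<And>v'. mset v' = mset v \<Longrightarrow> Q (w @ v')"
  shows "h * nf v \<in> normal_span Q"
proof -
  have "lbs.span {rmul h v' |v'. mset v' = mset v} \<subseteq> normal_span Q"
    using assms(1,3) by (intro lbs.span_minimal subspace_normal_span) (auto intro: normal_spanI normal_rmul)
  then show ?thesis using mult_nf_right[OF assms(2)] by blast
qed

lemma normal_span_nf_span: "normal_span (\<lambda>w. word_less deg w u) \<subseteq> nf_span (\<lambda>w. word_less deg w u)"
proof (intro normal_span_minimal subspace_nf_span)
  fix h w assume w: "normal h w" "word_less deg w u"
  then have "h \<in> nf_span (\<lambda>v. word_le deg v w)"
    using normal_monic_at by (simp add: monic_at_iff)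
  then show "h \<in> nf_span (\<lambda>w. word_less deg w u)"
    by (rule nf_span_mono) (use w(2) word_less_trans in blast)
qed

lemma trivial_mod_iff:
  "u \<noteq> [] \<Longrightarrow> trivial_mod deg S (nf u) f \<longleftrightarrow> f \<in> normal_span (\<lambda>w. word_less deg w u)"
proof -
  assume u: "u \<noteq> []"
  have "{p \<in> normal_polys deg S. nf_less deg (lead deg p) (nf u)} =
      {h. \<exists>w. normal h w \<and> word_less deg w u}"
    using u by (auto simp: normal_polys_iff lead_normal nf_less_nf normal_nonempty)
  then show ?thesis by (simp add: trivial_mod_def normal_span_def)
qed

lemma trivial_mod_deg_iff:
  "trivial_mod_deg deg S n f \<longleftrightarrow> f \<in> normal_span (\<lambda>w. word_deg deg w \<le> n)"
proof -
  have deg: "nf_deg deg (lead deg h) = word_deg deg w" if "normal h w" for h w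
    using that by (simp add: lead_normal nf_deg_def word_deg_def normal_nonempty)
  have "{p \<in> normal_polys deg S. nf_deg deg (lead deg p) \<le> n} =
      {h. \<exists>w. normal h w \<and> word_deg deg w \<le> n}"
    by (auto simp: normal_polys_iff deg)
  then show ?thesis by (simp add: trivial_mod_deg_def normal_span_def)
qed

lemma normal_gen_ideal:
  assumes "normal h w"
  shows "h \<in> lbs.gen_ideal S"
proof -
  have I: "lbs.is_ideal (lbs.gen_ideal S)"
    using lbs.graded_ideal_gen_ideal[of S] by (simp add: lbs.graded_ideal_def)
  have r: "rmul f a \<in> lbs.gen_ideal S" if "f \<in> lbs.gen_ideal S" for f a
    using that by (induction a arbitrary: f) (use I in \<open>auto simp: lbs.is_ideal_def\<close>)
  have "s \<in> lbs.gen_ideal S" if "s \<in> S" for s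
    using that lbs.gen_ideal_superset by blast
  with assms r I show ?thesis
    by (induction rule: normal.induct) (auto simp: lbs.is_ideal_def)
qed

lemma normal_span_gen_ideal: "normal_span Q \<subseteq> lbs.gen_ideal S"
proof (rule normal_span_minimal)
  show "lbs.subspace (lbs.gen_ideal S)"
    using lbs.graded_ideal_gen_ideal[of S] by (simp add: lbs.graded_ideal_def lbs.is_ideal_def)
qed (auto intro: normal_gen_ideal)

end

section \<open>From Groebner-Shirshov bases to leading words of the ideal\<close>

text \<open>The two composition conditions in terms of words, made uniform: zero products and
  polynomials \<open>h\<close> built from \<open>s\<close> itself are included, so later arguments
  need no exceptions.\<close>

locale gs_set = monic_homogeneous_set +
  assumes left_mult: "s \<in> S \<Longrightarrow> monic_at deg s u \<Longrightarrow> length u > 1 \<Longrightarrow> a \<noteq> [] \<Longrightarrow>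
      nf a * s \<in> normal_span (\<lambda>w. word_deg deg w \<le> word_deg deg a + word_deg deg u)"
    and inclusion: "s \<in> S \<Longrightarrow> monic_at deg s u \<Longrightarrow> normal h u \<Longrightarrow>
      s - h \<in> normal_span (\<lambda>w. word_less deg w u)"
begin

section \<open>Left multiplication of normal polynomials\<close>

text \<open>The Leibniz identity expresses \<open>nf a * (h * gen x)\<close> through
  \<open>(nf a * h) * gen x\<close> and \<open>(nf a * gen x) * h\<close>. The second product has
  \<open>a @ [x]\<close> in place of \<open>a\<close>, so the bound is assumed for all words at
  once.\<close>

lemma nf_mult_rmul:
  assumes "h \<in> lgrade i" "a \<noteq> []"
    and "\<And>a. a \<noteq> [] \<Longrightarrow> nf a * h \<in> normal_span (\<lambda>w. word_deg deg w \<le> word_deg deg a + n)"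
  shows "nf a * rmul h b \<in> normal_span (\<lambda>w. word_deg deg w \<le> word_deg deg a + (n + word_deg deg b))"
  using assms(1,3)
proof (induction b arbitrary: h i n)
  case Nil
  then show ?case using assms(2) by simp
next
  case (Cons x b)
  have "nf a * (h * gen x) \<in> normal_span (\<lambda>w. word_deg deg w \<le> word_deg deg a + (n + deg x))"
    if "a \<noteq> []" for a
  proof -
    have "rmul (nf a * h) [x] \<in> normal_span (\<lambda>w. word_deg deg w \<le> word_deg deg a + (n + deg x))"
      by (rule normal_span_rmul[OF Cons.prems(2)[OF that]]) simp
    moreover have "nf a * gen x * h \<in> normal_span (\<lambda>w. word_deg deg w \<le> word_deg deg a + (n + deg x))"
      using Cons.prems(2)[of "a @ [x]"] by (simp add: nf_mult_gen[OF that] add_ac)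
    ultimately show ?thesis
      unfolding leibniz_any[OF Cons.prems(1) gen_grade]
      by (simp add: normal_span_diff normal_span_scale)
  qed
  from Cons.IH[OF lbs.mult_grade[OF Cons.prems(1) gen_grade] this]
  show ?case by (simp add: add_ac)
qed

text \<open>By \<open>nf_mult_rmul\<close> the trailing letters can be stripped. What remains is
  \<open>nf a * s\<close>, which is a left multiplication composition or itself normal, or
  \<open>nf a * (nf c * s)\<close>, to which the Leibniz identity applies.\<close>

lemma nf_mult_normal:
  assumes "normal h w" "a \<noteq> []"
  shows "nf a * h \<in> normal_span (\<lambda>v. word_deg deg v \<le> word_deg deg a + word_deg deg w)"
  using assms(1)
proof cases
  case (prefix s u b)
  obtain i where i: "s \<in> lgrade i" using S_grade prefix(3) by blast
  have "nf a * s \<in> normal_span (\<lambda>v. word_deg deg v \<le> word_deg deg a + word_deg deg u)"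
    if "a \<noteq> []" for a
  proof (cases "length u > 1")
    case True
    then show ?thesis using left_mult prefix that by blast
  next
    case False
    then obtain x where "u = [x]"
      using monic_at_nonempty[OF prefix(4)] by (cases u) auto
    then show ?thesis using normal_nf_mult[of s x a] prefix that by (auto intro: normal_spanI)
  qed
  from nf_mult_rmul[OF i assms(2) this] show ?thesis using prefix by simp
next
  case (inner s x c b)
  obtain i where i: "s \<in> lgrade i" using S_grade inner(3) by blast
  have "nf a * (nf c * s) \<in> normal_span (\<lambda>v. word_deg deg v \<le> word_deg deg a + word_deg deg (c @ [x]))"
    (is "_ \<in> normal_span ?Q") if a: "a \<noteq> []" for a
  proof -
    \<comment> \<open>Expanding the first two factors gives words starting with \<open>a\<close>,
      each of which forms a normal polynomial with \<open>s\<close>.\<close>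
    have "nf a * nf c * s \<in> normal_span ?Q"
    proof (rule linear_span_subset[OF linear_mult_right subspace_normal_span _ nf_mult_nf[OF a inner(5)]])
      fix g :: "('a, 'b) lbs" assume "g \<in> {nf (a @ c') |c'. mset c' = mset c}"
      then obtain c' where c': "g = nf (a @ c')" "mset c' = mset c" by blast
      have "normal (nf (a @ c') * s) ((a @ c') @ [x])"
        using a by (intro normal_nf_mult[OF inner(3,4)]) simp
      then show "g * s \<in> normal_span ?Q"
        unfolding c'(1) by (rule normal_spanI) (simp add: word_deg_cong_mset[OF c'(2)])
    qed
    moreover have "nf a * s * nf c \<in> normal_span ?Q"
      by (rule normal_mult_nf[OF normal_nf_mult[OF inner(3,4) a] inner(5)])
        (auto dest: word_deg_cong_mset[where deg = deg])
    ultimately show ?thesis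
      unfolding leibniz_any[OF nf_grade[OF inner(5)] i]
      by (simp add: normal_span_diff normal_span_scale)
  qed
  from nf_mult_rmul[OF lbs.mult_grade[OF nf_grade[OF inner(5)] i] assms(2) this, where b = b]
  show ?thesis using inner by (simp add: add_ac)
qed

section \<open>Normal polynomials with a common leading word\<close>

text \<open>A normal polynomial with a smaller one-letter leading word lies in \<open>S\<close>, so
  its product with \<open>nf a\<close> is normal. In the other case the degree is strictly smaller,
  and the bound of \<open>nf_mult_normal\<close> on degrees gives the bound in the order.\<close>

lemma nf_mult_normal_span_less:
  assumes "f \<in> normal_span (\<lambda>w. word_less deg w [x])" "a \<noteq> []"
  shows "nf a * f \<in> normal_span (\<lambda>w. word_less deg w (a @ [x]))"
proof (rule normal_span_linear[OF linear_mult_left subspace_normal_span _ assms(1)])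
  fix h w assume h: "normal h w" "word_less deg w [x]"
  then consider y where "w = [y]" | "word_deg deg w < deg x"
    using word_less_singleton normal_nonempty by blast
  then show "nf a * h \<in> normal_span (\<lambda>w. word_less deg w (a @ [x]))"
  proof cases
    case 1
    then have "normal (nf a * h) (a @ w)"
      using normal_singleton h(1) normal_nf_mult assms(2) by blast
    then show ?thesis
      by (rule normal_spanI) (rule word_less_append_left[OF h(2)])
  next
    case 2
    show ?thesis
      by (rule normal_span_mono[OF nf_mult_normal[OF h(1) assms(2)]])
        (use 2 in \<open>simp add: word_less_def\<close>)
  qed
qed

text \<open>Two normal polynomials that reduce disjoint parts of the same word: both are compared with
  the element in which both parts are reduced.\<close>

lemma disjoint_diff:
  assumes p: "normal p c" and s: "s \<in> S" "monic_at deg s [x]"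
  shows "p * gen x - nf c * s \<in> normal_span (\<lambda>w. word_less deg w (c @ [x]))" (is "_ \<in> ?N")
proof -
  have "p * (s - gen x) \<in> ?N"
  proof (rule linear_span_subset[OF linear_mult_left subspace_normal_span])
    show "s - gen x \<in> lbs.span (nf ` {v. v \<noteq> [] \<and> word_less deg v [x]})"
      using s(2) by (simp add: monic_at_def nf_span_def)
    fix \<nu> :: "('a, 'b) lbs" assume "\<nu> \<in> nf ` {v. v \<noteq> [] \<and> word_less deg v [x]}"
    then obtain v where v: "v \<noteq> []" "word_less deg v [x]" "\<nu> = nf v" by blast
    then consider y where "v = [y]" | "word_deg deg v < deg x"
      using word_less_singleton by blast
    then show "p * \<nu> \<in> ?N"
    proof cases
      case 1
      then show ?thesis
        using v normal_rmul[OF p, of v] by (auto intro!: normal_spanI word_less_append_left)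
    next
      case 2
      show ?thesis
        unfolding v(3)
        by (rule normal_mult_nf[OF p v(1)]) (use 2 in \<open>auto simp: word_less_def dest: word_deg_cong_mset[where deg = deg]\<close>)
    qed
  qed
  moreover have "(p - nf c) * s \<in> ?N"
  proof (rule linear_span_subset[OF linear_mult_right subspace_normal_span])
    show "p - nf c \<in> lbs.span (nf ` {v. v \<noteq> [] \<and> word_less deg v c})"
      using normal_monic_at[OF p] by (simp add: monic_at_def nf_span_def)
    fix \<nu> :: "('a, 'b) lbs" assume "\<nu> \<in> nf ` {v. v \<noteq> [] \<and> word_less deg v c}"
    then show "\<nu> * s \<in> ?N"
      using normal_nf_mult[OF s] by (auto intro!: normal_spanI word_less_append_right)
  qed
  \<comment> \<open>The two occurrences of \<open>p * s\<close> cancel in this difference.\<close>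
  ultimately have "(p - nf c) * s - p * (s - gen x) \<in> ?N"
    by (rule normal_span_diff[rotated])
  then show ?thesis
    by (simp add: lbs.mult_diff_left lbs.mult_diff_right)
qed

lemma normal_diff_rmul:
  assumes "f - g \<in> normal_span (\<lambda>v. word_less deg v u)"
  shows "rmul f a - rmul g a \<in> normal_span (\<lambda>v. word_less deg v (u @ a))"
proof -
  interpret R: Vector_Spaces.linear lscale lscale "\<lambda>f. rmul f a" by (rule linear_rmul)
  show ?thesis
    unfolding R.diff[symmetric] by (rule normal_span_rmul[OF assms]) (rule word_less_append_right)
qed

text \<open>The shorter of the two leading words is a prefix of the longer one. This nesting is an
  inclusion composition, multiplied from the right by \<open>a\<close>.\<close>

lemma prefix_prefix_diff:
  assumes "s \<in> S" "monic_at deg s u" "t \<in> S" "monic_at deg t v" "u @ a = v @ b"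
    "length v \<le> length u"
  shows "rmul s a - rmul t b \<in> normal_span (\<lambda>w. word_less deg w (u @ a))"
proof -
  obtain c where c: "u = v @ c" "b = c @ a"
    using assms(5,6) unfolding append_eq_append_conv2 by fastforce
  have "normal (rmul t c) u" using prefix[OF assms(3,4)] c(1) by simp
  from normal_diff_rmul[OF inclusion[OF assms(1,2) this]] show ?thesis using c by simp
qed

text \<open>If the reduced letters sit at the same position, they coincide and the inclusion
  composition of \<open>s\<close> and \<open>t\<close> is multiplied from both sides. Otherwise they
  are disjoint and \<open>disjoint_diff\<close> applies at the later letter.\<close>

lemma inner_inner_diff:
  assumes "s \<in> S" "monic_at deg s [x]" "t \<in> S" "monic_at deg t [y]" "a \<noteq> []" "c \<noteq> []"
    "a @ x # b = c @ y # d" "length a \<le> length c"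
  shows "rmul (nf a * s) b - rmul (nf c * t) d \<in> normal_span (\<lambda>w. word_less deg w (a @ x # b))"
proof (cases "length a = length c")
  case True
  then have eq: "c = a" "y = x" "d = b" using assms(7) by auto
  have "s - t \<in> normal_span (\<lambda>w. word_less deg w [x])"
    using inclusion[OF assms(1,2) normal_S] assms(3,4) eq by simp
  from nf_mult_normal_span_less[OF this assms(5)]
  have "nf a * s - nf a * t \<in> normal_span (\<lambda>w. word_less deg w (a @ [x]))"
    by (simp add: lbs.mult_diff_right)
  from normal_diff_rmul[OF this] show ?thesis using eq by simp
next
  case False
  then have less: "length a < length c" using assms(8) by simp
  then obtain e' where e': "c = a @ e'" "x # b = e' @ y # d"
    using assms(7) unfolding append_eq_append_conv2 by fastforce
  with less obtain e where e: "c = a @ x # e" "b = e @ y # d"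
    by (cases e') auto
  have "normal (rmul (nf a * s) e) c" using inner[OF assms(1,2,5)] e by simp
  from normal_diff_rmul[OF disjoint_diff[OF this assms(3,4)]] show ?thesis using e by simp
qed

text \<open>The reduced letter \<open>x\<close> lies either behind \<open>u\<close>, where the
  reductions are disjoint, or inside \<open>u\<close>, where they form an inclusion
  composition.\<close>

lemma prefix_inner_diff:
  assumes "s \<in> S" "monic_at deg s u" "t \<in> S" "monic_at deg t [x]" "c \<noteq> []" "u @ a = c @ x # b"
  shows "rmul s a - rmul (nf c * t) b \<in> normal_span (\<lambda>w. word_less deg w (u @ a))"
proof (cases "length u \<le> length c")
  case True
  then obtain e where e: "c = u @ e" "a = e @ x # b"
    using assms(6) unfolding append_eq_append_conv2 by fastforce
  have "normal (rmul s e) c" using prefix[OF assms(1,2)] e by simp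
  from normal_diff_rmul[OF disjoint_diff[OF this assms(3,4)]] show ?thesis using e by simp
next
  case False
  then obtain e' where e': "u = c @ e'" "e' @ a = x # b" "e' \<noteq> []"
    using assms(6) unfolding append_eq_append_conv2 by fastforce
  then obtain e where e: "u = c @ x # e" "b = e @ a"
    by (cases e') auto
  have "normal (rmul (nf c * t) e) u" using inner[OF assms(3,4,5)] e by simp
  from normal_diff_rmul[OF inclusion[OF assms(1,2) this]] show ?thesis using e by simp
qed

lemma normal_diff:
  assumes "normal h w" "normal h' w"
  shows "h - h' \<in> normal_span (\<lambda>v. word_less deg v w)" (is "_ \<in> ?N")
proof -
  have sym: "f - g \<in> ?N" if "g - f \<in> ?N" for f g
    using normal_span_neg[OF that] by simp
  show ?thesis
    using assms(1)
  proof cases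
    case h: (prefix s u a)
    from assms(2) show ?thesis
    proof cases
      case h': (prefix t v b)
      then have eq: "u @ a = v @ b" using h by simp
      show ?thesis
      proof (cases "length v \<le> length u")
        case True
        then show ?thesis
          unfolding h(1,2) h'(1) by (rule prefix_prefix_diff[OF h(3,4) h'(3,4) eq])
      next
        case False
        then have "h' - h \<in> ?N"
          unfolding h(1) h'(1,2) by (intro prefix_prefix_diff[OF h'(3,4) h(3,4) eq[symmetric]]) simp
        then show ?thesis by (rule sym)
      qed
    next
      case h': (inner t x c b)
      then have eq: "u @ a = c @ x # b" using h by simp
      show ?thesis
        unfolding h(1,2) h'(1) by (rule prefix_inner_diff[OF h(3,4) h'(3-5) eq])
    qed
  next
    case h: (inner s x a b)
    from assms(2) show ?thesis
    proof cases
      case h': (prefix t v c)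
      then have eq: "v @ c = a @ x # b" using h by simp
      have "h' - h \<in> ?N"
        unfolding h(1) h'(1,2) by (rule prefix_inner_diff[OF h'(3,4) h(3-5) eq])
      then show ?thesis by (rule sym)
    next
      case h': (inner t y c d)
      then have eq: "a @ x # b = c @ y # d" using h by simp
      show ?thesis
      proof (cases "length a \<le> length c")
        case True
        then show ?thesis
          unfolding h(1,2) h'(1) by (rule inner_inner_diff[OF h(3,4) h'(3,4) h(5) h'(5) eq])
      next
        case False
        then have "h' - h \<in> ?N"
          unfolding h(1) h'(1,2)
          by (intro inner_inner_diff[OF h'(3,4) h(3,4) h'(5) h(5) eq[symmetric]]) simp
        then show ?thesis by (rule sym)
      qed
    qed
  qed
qed

section \<open>Leading words of elements of the ideal\<close>

text \<open>The span is itself a graded ideal containing \<open>S\<close>. Closure under left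
  multiplication is the point at which the left multiplication compositions enter, through
  \<open>nf_mult_normal\<close>.\<close>

lemma gen_ideal_normal_span: "lbs.gen_ideal S \<subseteq> normal_span (\<lambda>_. True)" (is "_ \<subseteq> ?N")
proof (rule lbs.gen_ideal_minimal)
  show "S \<subseteq> ?N"
    using ex_monic_at_S normal_spanI[OF normal_S TrueI] by blast
  have left: "g * f \<in> ?N" if f: "f \<in> ?N" for f g
  proof (rule linear_span_subset[OF linear_mult_right subspace_normal_span, where A = NF])
    fix \<mu> :: "('a, 'b) lbs" assume "\<mu> \<in> NF"
    then obtain a where a: "a \<noteq> []" "\<mu> = nf a" by (auto simp: NF_def)
    show "\<mu> * f \<in> ?N"
      unfolding a(2)
      by (rule normal_span_linear[OF linear_mult_left subspace_normal_span _ f])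
        (rule normal_span_mono[OF nf_mult_normal[OF _ a(1)]], assumption, rule TrueI)
  qed (simp add: span_NF)
  have right: "f * g \<in> ?N" if f: "f \<in> ?N" for f g
  proof (rule linear_span_subset[OF linear_mult_left subspace_normal_span, where A = NF])
    fix \<mu> :: "('a, 'b) lbs" assume "\<mu> \<in> NF"
    then obtain a where a: "a \<noteq> []" "\<mu> = nf a" by (auto simp: NF_def)
    show "f * \<mu> \<in> ?N"
      unfolding a(2)
      by (rule normal_span_linear[OF linear_mult_right subspace_normal_span _ f])
        (rule normal_mult_nf[OF _ a(1)], assumption, rule TrueI)
  qed (simp add: span_NF)
  \<comment> \<open>The elements whose homogeneous components both lie in the span. This is a
    subspace containing each normal polynomial, since those are homogeneous; hence the span is
    graded.\<close>
  let ?G = "{f. \<exists>y\<in>?N \<inter> lgrade 0. \<exists>z\<in>?N \<inter> lgrade 1. f = y + z}"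
  have "lbs.subspace ?G"
  proof (rule lbs.subspaceI)
    have "0 \<in> ?N \<inter> lgrade i" for i by (simp add: normal_span_zero lbs.grade_zero)
    moreover have "0 = 0 + (0 :: ('a, 'b) lbs)" by simp
    ultimately show "0 \<in> ?G" by blast
    fix c and f g :: "('a, 'b) lbs"
    assume "f \<in> ?G"
    then obtain y z where f: "y \<in> ?N \<inter> lgrade 0" "z \<in> ?N \<inter> lgrade 1" "f = y + z" by blast
    then have "lscale c y \<in> ?N \<inter> lgrade 0" "lscale c z \<in> ?N \<inter> lgrade 1"
      "lscale c f = lscale c y + lscale c z"
      by (auto simp: normal_span_scale lbs.grade_scale lbs.scale_right_distrib)
    then show "lscale c f \<in> ?G" by blast
    assume "g \<in> ?G"
    then obtain y' z' where g: "y' \<in> ?N \<inter> lgrade 0" "z' \<in> ?N \<inter> lgrade 1" "g = y' + z'" by blast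
    have "y + y' \<in> ?N \<inter> lgrade 0" "z + z' \<in> ?N \<inter> lgrade 1" "f + g = (y + y') + (z + z')"
      using f g by (auto simp: normal_span_add lbs.grade_add)
    then show "f + g \<in> ?G" by blast
  qed
  moreover have "h \<in> ?G" if h: "normal h w" for h w
  proof -
    obtain i where i: "h \<in> lgrade i" using normal_grade[OF h] by blast
    have N: "h \<in> ?N \<inter> lgrade i" "0 \<in> ?N \<inter> lgrade j" for j
      using i normal_spanI[OF h] by (simp_all add: normal_span_zero lbs.grade_zero)
    have "h = h + 0" "h = 0 + h" by simp_all
    with N show ?thesis by (cases i) blast+
  qed
  ultimately have "?N \<subseteq> ?G" by (rule normal_span_minimal)
  then show "lbs.graded_ideal ?N"
    unfolding lbs.graded_ideal_def lbs.is_ideal_def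
    using subspace_normal_span left right by blast
qed

text \<open>A linear combination involves finitely many normal polynomials, so one of their leading
  words is largest. Zero is kept apart because no word need satisfy \<open>Q\<close>.\<close>

lemma normal_span_bounded:
  assumes "f \<in> normal_span Q" "f \<noteq> 0"
  shows "\<exists>u. u \<noteq> [] \<and> Q u \<and> f \<in> normal_span (\<lambda>w. word_le deg w u)"
proof -
  let ?V = "{f. f = 0 \<or> (\<exists>u. u \<noteq> [] \<and> Q u \<and> f \<in> normal_span (\<lambda>w. word_le deg w u))}"
  have "lbs.subspace ?V"
  proof (rule lbs.subspaceI)
    fix f g :: "('a, 'b) lbs" assume fg: "f \<in> ?V" "g \<in> ?V"
    show "f + g \<in> ?V"
    proof (cases "f = 0 \<or> g = 0")
      case False
      with fg obtain u v where u: "u \<noteq> []" "Q u" "f \<in> normal_span (\<lambda>w. word_le deg w u)"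
        and v: "v \<noteq> []" "Q v" "g \<in> normal_span (\<lambda>w. word_le deg w v)" by blast
      have "\<exists>m\<in>{u, v}. word_le deg u m \<and> word_le deg v m"
        using word_less_total[of deg u v] by auto
      then obtain m where m: "m \<in> {u, v}" "word_le deg u m" "word_le deg v m" by blast
      have "f \<in> normal_span (\<lambda>w. word_le deg w m)" "g \<in> normal_span (\<lambda>w. word_le deg w m)"
        using m by (auto intro: normal_span_mono[OF u(3)] normal_span_mono[OF v(3)] dest: word_less_trans)
      then have "f + g \<in> normal_span (\<lambda>w. word_le deg w m)" by (rule normal_span_add)
      with m u v show ?thesis by blast
    qed (use fg in auto)
  qed (auto simp: normal_span_scale)
  moreover have "h \<in> ?V" if "normal h w" "Q w" for h w
    using that normal_nonempty[OF that(1)] normal_spanI[OF that(1), of "\<lambda>v. word_le deg v w"] by blast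
  ultimately have "normal_span Q \<subseteq> ?V" by (rule normal_span_minimal)
  with assms show ?thesis by blast
qed

text \<open>By \<open>normal_diff\<close> every normal polynomial with leading word \<open>u\<close>
  agrees with one fixed \<open>h\<close> up to smaller ones, so all top terms merge into a single
  multiple of \<open>h\<close>.\<close>

lemma normal_span_top:
  assumes "f \<in> normal_span (\<lambda>w. word_le deg w u)"
  shows "f \<in> normal_span (\<lambda>w. word_less deg w u) \<or>
    (\<exists>h c. normal h u \<and> c \<noteq> 0 \<and> f - lscale c h \<in> normal_span (\<lambda>w. word_less deg w u))"
proof (cases "\<exists>h. normal h u")
  case False
  then have "f \<in> normal_span (\<lambda>w. word_less deg w u)"
    by (intro normal_span_mono[OF assms]) auto
  then show ?thesis ..
next
  case True
  then obtain h where h: "normal h u" by blast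
  let ?V = "{f. \<exists>c. f - lscale c h \<in> normal_span (\<lambda>w. word_less deg w u)}"
  have "lbs.subspace ?V"
  proof (rule lbs.subspaceI)
    show "0 \<in> ?V" by (auto intro!: exI[of _ 0] simp: normal_span_zero)
    fix c and f g :: "('a, 'b) lbs"
    assume "f \<in> ?V"
    then obtain a where a: "f - lscale a h \<in> normal_span (\<lambda>w. word_less deg w u)" by blast
    then have "lscale c f - lscale (c * a) h \<in> normal_span (\<lambda>w. word_less deg w u)"
      using normal_span_scale[OF a, of c] by (simp add: lbs.scale_right_diff_distrib)
    then show "lscale c f \<in> ?V" by blast
    assume "g \<in> ?V"
    then obtain b where b: "g - lscale b h \<in> normal_span (\<lambda>w. word_less deg w u)" by blast
    have "f + g - lscale (a + b) h \<in> normal_span (\<lambda>w. word_less deg w u)"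
      using normal_span_add[OF a b] by (simp add: lbs.scale_left_distrib algebra_simps)
    then show "f + g \<in> ?V" by blast
  qed
  moreover have "g \<in> ?V" if g: "normal g w" "word_le deg w u" for g w
  proof (cases "w = u")
    case True
    then have "g - lscale 1 h \<in> normal_span (\<lambda>w. word_less deg w u)"
      using normal_diff[of g u h] g(1) h by simp
    then show ?thesis by blast
  next
    case False
    then have "g - lscale 0 h \<in> normal_span (\<lambda>w. word_less deg w u)"
      using g normal_spanI[OF g(1), of "\<lambda>w. word_less deg w u"] by simp
    then show ?thesis by blast
  qed
  ultimately have "normal_span (\<lambda>w. word_le deg w u) \<subseteq> ?V"
    by (rule normal_span_minimal)
  with assms obtain c where c: "f - lscale c h \<in> normal_span (\<lambda>w. word_less deg w u)" by blast
  show ?thesis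
  proof (cases "c = 0")
    case True
    with c show ?thesis by simp
  qed (use c h in blast)
qed

text \<open>If the merged top coefficient is nonzero, nothing can cancel it and \<open>u\<close> is
  the leading word of \<open>f\<close>. Otherwise \<open>f\<close> lies strictly below
  \<open>u\<close>, and \<open>normal_span_bounded\<close> supplies a smaller bound for the
  well-founded induction.\<close>

lemma normal_span_lead:
  assumes "f \<in> normal_span (\<lambda>w. word_le deg w u)" "f \<noteq> 0"
  shows "\<exists>h w. normal h w \<and> lead deg f = nf w"
  using wf_word_less[of deg] assms
proof (induction u rule: wf_induct_rule)
  case (less u)
  from normal_span_top[OF less.prems(1)] show ?case
  proof (elim disjE exE conjE)
    assume "f \<in> normal_span (\<lambda>w. word_less deg w u)"
    from normal_span_bounded[OF this less.prems(2)] less.IH less.prems(2) show ?case by blast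
  next
    fix h c assume h: "normal h u" "c \<noteq> 0" "f - lscale c h \<in> normal_span (\<lambda>w. word_less deg w u)"
    then have d: "f - lscale c h \<in> nf_span (\<lambda>w. word_less deg w u)"
      using normal_span_nf_span by blast
    have m: "u \<noteq> []" "coeff h (nf u) = 1" "h \<in> nf_span (\<lambda>w. word_le deg w u)"
      using normal_monic_at[OF h(1)] by (auto simp: monic_at_iff)
    have "coeff f (nf u) = c"
    proof (rule ccontr)
      assume "coeff f (nf u) \<noteq> c"
      then have "coeff (f - lscale c h) (nf u) \<noteq> 0" using m(2) by (simp add: coeff_diff coeff_scale)
      then have "word_less deg u u" using d m(1) unfolding nf_span_iff by blast
      then show False by simp
    qed
    moreover have "f \<in> nf_span (\<lambda>w. word_le deg w u)"
    proof -
      have "f - lscale c h \<in> nf_span (\<lambda>w. word_le deg w u)"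
        by (rule nf_span_mono[OF d]) simp
      from lbs.subspace_add[OF subspace_nf_span this lbs.subspace_scale[OF subspace_nf_span m(3), of c]]
      show ?thesis by simp
    qed
    ultimately have "lead deg f = nf u"
      using m(1) h(2) by (intro lead_eqI) auto
    with h(1) show ?case by blast
  qed
qed

lemma gen_ideal_lead:
  assumes "f \<in> lbs.gen_ideal S" "f \<noteq> 0"
  shows "\<exists>h w. normal h w \<and> lead deg f = nf w"
proof -
  have "f \<in> normal_span (\<lambda>_. True)" using assms(1) gen_ideal_normal_span by blast
  from normal_span_bounded[OF this assms(2)] show ?thesis
    using normal_span_lead assms(2) by blast
qed

end

section \<open>Reduction modulo normal polynomials\<close>

context superalgebra
begin

text \<open>Passing to cosets is linear, so images and preimages of subspaces under it are
  subspaces.\<close>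

lemma quot_span_coset:
  assumes "subspace I"
  shows "quot_span I (coset I ` T) = coset I ` span T"
proof
  have "quot_subspace I (coset I ` span T)"
    unfolding quot_subspace_def quot_def
    using span_zero[of T] span_add[of _ T] span_scale[of _ T]
    by (auto simp: quot_add_coset[OF assms] quot_scale_coset[OF assms])
  then show "quot_span I (coset I ` T) \<subseteq> coset I ` span T"
    unfolding quot_span_def by (intro hull_minimal) (auto intro: span_base)
  show "coset I ` span T \<subseteq> quot_span I (coset I ` T)"
    unfolding quot_span_def hull_def
  proof (intro Inter_greatest)
    fix W assume "W \<in> {W. quot_subspace I W \<and> coset I ` T \<subseteq> W}"
    then have W: "quot_subspace I W" "coset I ` T \<subseteq> W" by auto
    have "subspace (coset I -` W)"
      using W(1) unfolding quot_subspace_def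
      by (intro subspaceI) (auto simp flip: quot_add_coset[OF assms] quot_scale_coset[OF assms])
    then have "span T \<subseteq> coset I -` W"
      using W(2) by (intro span_minimal) auto
    then show "coset I ` span T \<subseteq> W" by blast
  qed
qed

lemma basis_of_quot_iff:
  assumes "subspace I"
  shows "basis_of_quot I T \<longleftrightarrow>
    (\<forall>f. \<exists>t\<in>span T. f - t \<in> I) \<and> (\<forall>t\<in>T. \<forall>g\<in>span (T - {t}). t - g \<notin> I)"
proof -
  note eq = coset_eq_iff[OF assms]
  have spans: "coset I ` span T = quot I \<longleftrightarrow> (\<forall>f. \<exists>t\<in>span T. f - t \<in> I)"
  proof -
    have "coset I ` span T = quot I \<longleftrightarrow> (\<forall>f. \<exists>t\<in>span T. coset I f = coset I t)"
      unfolding quot_def by blast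
    then show ?thesis by (simp add: eq)
  qed
  \<comment> \<open>Injectivity ensures that removing one coset removes exactly one
    representative.\<close>
  have indep: "(\<forall>A\<in>coset I ` T. A \<notin> quot_span I (coset I ` T - {A})) \<longleftrightarrow>
      (\<forall>t\<in>T. \<forall>g\<in>span (T - {t}). t - g \<notin> I)" if inj: "inj_on (coset I) T"
  proof -
    have "coset I ` T - {coset I t} = coset I ` (T - {t})" if "t \<in> T" for t
      using inj that by (auto simp: inj_on_def)
    then have "(\<forall>A\<in>coset I ` T. A \<notin> quot_span I (coset I ` T - {A})) \<longleftrightarrow>
        (\<forall>t\<in>T. coset I t \<notin> coset I ` span (T - {t}))"
      by (simp add: quot_span_coset[OF assms])
    also have "\<dots> \<longleftrightarrow> (\<forall>t\<in>T. \<forall>g\<in>span (T - {t}). t - g \<notin> I)"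
      by (auto simp: eq image_iff)
    finally show ?thesis .
  qed
  \<comment> \<open>Two elements with the same coset would violate independence, one being in the
    span of the elements other than the first.\<close>
  have inj: "inj_on (coset I) T" if "\<forall>t\<in>T. \<forall>g\<in>span (T - {t}). t - g \<notin> I"
  proof (rule inj_onI, rule ccontr)
    fix t g assume "t \<in> T" "g \<in> T" "coset I t = coset I g" "t \<noteq> g"
    moreover from this have "g \<in> span (T - {t})" by (intro span_base) auto
    ultimately show False using that by (auto simp: eq)
  qed
  show ?thesis
    unfolding basis_of_quot_def quot_span_coset[OF assms, of T] spans
    using indep inj by blast
qed

end

section \<open>Compositions expressed by words\<close>

context monic_homogeneous_set
begin

lemma gs_basis_imp_gs_set:
  assumes "gs_basis deg S"
  shows "gs_set deg S"
proof
  fix s :: "('x, 'k) lbs" and u a :: "'x list"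
  assume s: "s \<in> S" "monic_at deg s u" and "length u > 1" "a \<noteq> []"
  show "nf a * s \<in> normal_span (\<lambda>w. word_deg deg w \<le> word_deg deg a + word_deg deg u)"
  proof (cases "nf a * s = 0")
    case True
    then show ?thesis by (simp add: normal_span_zero)
  next
    case False
    moreover have "nf a \<in> (NF :: ('x, 'k) lbs set)" using \<open>a \<noteq> []\<close> by (simp add: NF_def)
    moreover have "nf_length (lead deg s) > 1"
      using \<open>length u > 1\<close> nf_length_lead[OF s(2)] by simp
    ultimately have "trivial_mod_deg deg S
        (nf_deg deg (nf a :: ('x, 'k) lbs) + nf_deg deg (lead deg s)) (nf a * s)"
      using assms s(1) by (simp add: gs_basis_def)
    then show ?thesis
      using \<open>a \<noteq> []\<close> monic_at_nonempty[OF s(2)]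
      by (simp add: trivial_mod_deg_iff lead_monic_at[OF s(2)] nf_deg_def flip: word_deg_def)
  qed
next
  fix s h :: "('x, 'k) lbs" and u :: "'x list"
  assume s: "s \<in> S" "monic_at deg s u" and h: "normal h u"
  have comp: "s - h \<in> normal_span (\<lambda>w. word_less deg w u)"
    if "t \<in> S" "h \<in> normal_polys_of deg t" "s \<noteq> t" for t
  proof -
    have "lead deg s = lead deg h" using lead_monic_at[OF s(2)] lead_normal[OF h] by simp
    with assms s(1) that have "trivial_mod deg S (lead deg s) (s - h)"
      unfolding gs_basis_def by blast
    then show ?thesis
      using s(2) by (simp add: lead_monic_at trivial_mod_iff monic_at_nonempty)
  qed
  show "s - h \<in> normal_span (\<lambda>w. word_less deg w u)"
    using h
  proof cases
    case (prefix t v a)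
    show ?thesis
    proof (cases "s = t")
      \<comment> \<open>With equal leading words no letters are appended, so \<open>h\<close> is
        \<open>s\<close> itself.\<close>
      case True
      then have "v = u" using monic_at_unique s(2) prefix(4) by blast
      with True prefix show ?thesis by (simp add: normal_span_zero)
    next
      case False
      then show ?thesis
        using comp[OF prefix(3)] normal_polys_of_prefix[of t a] prefix(1) by simp
    qed
  next
    case (inner t x a b)
    show ?thesis
    proof (cases "s = t")
      \<comment> \<open>Impossible: the one-letter leading word of \<open>s\<close> would equal a
        word with the nonempty prefix \<open>a\<close> in front of a letter.\<close>
      case True
      then have "u = [x]" using monic_at_unique s(2) inner(4) by blast
      with inner show ?thesis by (cases a) auto
    next
      case False
      then show ?thesis
        using comp[OF inner(3)] normal_polys_of_inner[OF inner(4,5), of b] inner(1) by simp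
    qed
  qed
qed

section \<open>Irreducible words and reduction\<close>

abbreviation irreducible_word :: "'x list \<Rightarrow> bool"
  where "irreducible_word w \<equiv> \<nexists>h. normal h w"

lemma Irr_eq: "Irr deg S = nf ` {w. w \<noteq> [] \<and> irreducible_word w}"
proof -
  have "(\<forall>h\<in>normal_polys deg S. nf w \<noteq> lead deg h) \<longleftrightarrow> irreducible_word w" if "w \<noteq> []" for w
  proof -
    have "nf w \<noteq> lead deg h \<longleftrightarrow> w \<noteq> v" if "normal h v" for h v
      using that \<open>w \<noteq> []\<close> by (simp add: lead_normal normal_nonempty)
    then show ?thesis unfolding Ball_def normal_polys_iff by metis
  qed
  then show ?thesis by (auto simp: Irr_def NF_def)
qed

text \<open>Well-founded induction on words: a reducible \<open>nf w\<close> equals a normal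
  polynomial \<open>h\<close> minus the smaller remainder \<open>h - nf w\<close>. Downward closure
  of \<open>Q\<close> keeps the remainder within the bound.\<close>

lemma reduction:
  assumes "f \<in> nf_span Q" "\<And>v w. Q w \<Longrightarrow> word_less deg v w \<Longrightarrow> Q v"
  obtains g t where "g \<in> normal_span Q" "t \<in> nf_span (\<lambda>w. Q w \<and> irreducible_word w)" "f = g + t"
proof -
  let ?V = "{g + t |g t. g \<in> normal_span Q \<and> t \<in> nf_span (\<lambda>w. Q w \<and> irreducible_word w)}"
  have V: "lbs.subspace ?V"
    by (intro lbs.subspace_sums subspace_normal_span subspace_nf_span)
  have "nf w \<in> ?V" if "w \<noteq> []" "Q w" for w
    using wf_word_less[of deg] that
  proof (induction w rule: wf_induct_rule)
    case (less w)
    show ?case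
    proof (cases "\<exists>h. normal h w")
      case True
      then obtain h where h: "normal h w" by blast
      have "nf_span (\<lambda>v. word_less deg v w) \<subseteq> ?V"
        unfolding nf_span_def[of "\<lambda>v. word_less deg v w"]
        by (rule lbs.span_minimal[OF _ V]) (use less assms(2) in auto)
      then have d: "h - nf w \<in> ?V"
        using normal_monic_at[OF h] by (auto simp only: monic_at_def)
      have "h + 0 \<in> ?V"
        using normal_spanI[of h w Q, OF h less.prems(2)] lbs.subspace_0[OF subspace_nf_span] by blast
      from lbs.subspace_diff[OF V this d] show ?thesis by simp
    next
      case False
      then have "0 + nf w \<in> ?V"
        using normal_span_zero nf_spanI[OF less.prems(1), of "\<lambda>w. Q w \<and> irreducible_word w"]
          less.prems(2) by blast
      then show ?thesis by simp
    qed
  qed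
  then have "nf_span Q \<subseteq> ?V"
    unfolding nf_span_def[of Q] by (intro lbs.span_minimal[OF _ V]) auto
  with assms(1) that show thesis by blast
qed

lemma subspace_gen_ideal: "lbs.subspace (lbs.gen_ideal S)"
  using lbs.graded_ideal_gen_ideal[of S] by (simp add: lbs.graded_ideal_def lbs.is_ideal_def)

section \<open>Equivalence of both other conditions with the one on leading monomials\<close>

definition lead_condition :: bool
  where "lead_condition \<longleftrightarrow>
    (\<forall>f\<in>lbs.gen_ideal S. f \<noteq> 0 \<longrightarrow> (\<exists>h\<in>normal_polys deg S. lead deg f = lead deg h))"

text \<open>The leading word of a nonzero such element would be both irreducible and the leading
  word of a normal polynomial.\<close>

lemma irreducible_eq_zero:
  assumes lead_condition "f \<in> lbs.gen_ideal S" "f \<in> nf_span irreducible_word"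
  shows "f = 0"
proof (rule ccontr)
  assume "f \<noteq> 0"
  then obtain w where w: "w \<noteq> []" "coeff f (nf w) \<noteq> 0" "lead deg f = nf w"
    by (rule ex_lead_word)
  from assms(1,2) \<open>f \<noteq> 0\<close> obtain h v where "normal h v" "nf w = (nf v :: ('x, 'k) lbs)"
    unfolding lead_condition_def using w(3) by (metis lead_normal normal_polys_iff)
  then have "normal h w" using w(1) by (simp add: normal_nonempty)
  moreover have "irreducible_word w" using assms(3) w by (simp add: nf_span_iff)
  ultimately show False by blast
qed

text \<open>Reduction respects the bound \<open>Q\<close>, and its irreducible remainder stays in
  the ideal, hence vanishes. With suitable \<open>Q\<close> this yields triviality of both kinds of
  composition.\<close>

lemma gen_ideal_imp_normal_span:
  assumes lead_condition "f \<in> lbs.gen_ideal S" "f \<in> nf_span Q"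
    and down: "\<And>v w. Q w \<Longrightarrow> word_less deg v w \<Longrightarrow> Q v"
  shows "f \<in> normal_span Q"
proof -
  obtain g t where gt: "g \<in> normal_span Q" "t \<in> nf_span (\<lambda>w. Q w \<and> irreducible_word w)" "f = g + t"
    by (rule reduction[OF assms(3)]) (erule (1) down)
  have "g \<in> lbs.gen_ideal S" using gt(1) normal_span_gen_ideal by blast
  then have "t \<in> lbs.gen_ideal S"
    using lbs.subspace_diff[OF subspace_gen_ideal assms(2), of g] gt(3) by simp
  moreover have "t \<in> nf_span irreducible_word"
    using gt(2) by (rule nf_span_mono) blast
  ultimately have "t = 0" using irreducible_eq_zero[OF assms(1)] by blast
  with gt show ?thesis by simp
qed

lemma lead_condition_imp_gs_basis:
  assumes lead_condition
  shows "gs_basis deg S"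
  unfolding gs_basis_def
proof (intro conjI ballI impI)
  fix s \<mu> :: "('x, 'k) lbs" assume s: "s \<in> S" and "\<mu> \<in> NF"
  then obtain a where a: "a \<noteq> []" "\<mu> = nf a" by (auto simp: NF_def)
  obtain u where u: "monic_at deg s u" using ex_monic_at_S[OF s] by blast
  let ?Q = "\<lambda>w. word_deg deg w \<le> word_deg deg a + word_deg deg u"
  have "s \<in> lbs.span (nf ` {v. v \<noteq> [] \<and> word_le deg v u})"
    using u by (simp add: monic_at_iff nf_span_def)
  \<comment> \<open>The Leibniz expansion permutes letters and so preserves total degree.\<close>
  then have "nf a * s \<in> nf_span ?Q"
  proof (rule linear_span_subset[OF linear_mult_left subspace_nf_span, rotated])
    fix \<nu> :: "('x, 'k) lbs" assume "\<nu> \<in> nf ` {v. v \<noteq> [] \<and> word_le deg v u}"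
    then obtain v where v: "v \<noteq> []" "word_le deg v u" "\<nu> = nf v" by blast
    have "nf (a @ v') \<in> nf_span ?Q" if "mset v' = mset v" for v'
      using a(1) v(2) word_deg_cong_mset[OF that, of deg]
      by (intro nf_spanI) (auto simp: word_less_def)
    then have "lbs.span {nf (a @ v') |v'. mset v' = mset v} \<subseteq> nf_span ?Q"
      by (intro lbs.span_minimal subspace_nf_span) blast
    then show "nf a * \<nu> \<in> nf_span ?Q" using nf_mult_nf[OF a(1) v(1)] v(3) by blast
  qed
  moreover have "nf a * s \<in> lbs.gen_ideal S"
    using lbs.graded_ideal_gen_ideal[of S] lbs.gen_ideal_superset[of S] s
    unfolding lbs.graded_ideal_def lbs.is_ideal_def by blast
  ultimately have "nf a * s \<in> normal_span ?Q"
    by (intro gen_ideal_imp_normal_span[OF assms]) (auto simp: word_less_def)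
  then show "trivial_mod_deg deg S (nf_deg deg \<mu> + nf_deg deg (lead deg s)) (\<mu> * s)"
    using a monic_at_nonempty[OF u]
    by (simp add: trivial_mod_deg_iff lead_monic_at[OF u] nf_deg_def flip: word_deg_def)
next
  fix s t h assume s: "s \<in> S" "t \<in> S" and h: "h \<in> normal_polys_of deg t"
    and eq: "s \<noteq> t \<and> lead deg s = lead deg h"
  obtain u where u: "monic_at deg s u" using ex_monic_at_S[OF s(1)] by blast
  obtain w where w: "normal h w" using normal_polys_of_normal[OF s(2) h] by blast
  have "w = u"
    using eq lead_monic_at[OF u] lead_normal[OF w] monic_at_nonempty[OF u] normal_nonempty[OF w]
    by simp
  \<comment> \<open>Both elements are monic at \<open>u\<close>, so the leading terms cancel in
    \<open>s - h\<close>.\<close>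
  then have "s - nf u \<in> nf_span (\<lambda>v. word_less deg v u)" "h - nf u \<in> nf_span (\<lambda>v. word_less deg v u)"
    using u normal_monic_at[OF w] by (simp_all add: monic_at_def)
  from lbs.subspace_diff[OF subspace_nf_span this]
  have "s - h \<in> nf_span (\<lambda>v. word_less deg v u)" by simp
  moreover have "s - h \<in> lbs.gen_ideal S"
    using lbs.subspace_diff[OF subspace_gen_ideal _ normal_gen_ideal[OF w]]
      lbs.gen_ideal_superset[of S] s(1) by blast
  ultimately have "s - h \<in> normal_span (\<lambda>v. word_less deg v u)"
    by (intro gen_ideal_imp_normal_span[OF assms]) (auto intro: word_less_trans)
  then show "trivial_mod deg S (lead deg s) (s - h)"
    by (simp add: lead_monic_at[OF u] trivial_mod_iff monic_at_nonempty[OF u])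
qed

lemma gs_basis_iff: "gs_basis deg S \<longleftrightarrow> lead_condition"
proof
  assume "gs_basis deg S"
  then interpret gs_set deg S by (rule gs_basis_imp_gs_set)
  show lead_condition
    unfolding lead_condition_def
  proof (intro ballI impI)
    fix f assume "f \<in> lbs.gen_ideal S" "f \<noteq> 0"
    then obtain h w where "normal h w" "lead deg f = nf w" using gen_ideal_lead by blast
    then show "\<exists>h\<in>normal_polys deg S. lead deg f = lead deg h"
      by (intro bexI[of _ h]) (auto simp: lead_normal normal_polys_iff)
  qed
qed (rule lead_condition_imp_gs_basis)

lemma Irr_minus_nf:
  assumes "w \<noteq> []"
  shows "lbs.span (Irr deg S - {nf w}) = nf_span (\<lambda>v. irreducible_word v \<and> v \<noteq> w)"
proof -
  have "Irr deg S - {nf w} = nf ` {v. v \<noteq> [] \<and> irreducible_word v \<and> v \<noteq> w}"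
    using assms by (auto simp: Irr_eq)
  then show ?thesis by (simp add: nf_span_def)
qed

lemma basis_of_quot_Irr_iff: "lbs.basis_of_quot (lbs.gen_ideal S) (Irr deg S) \<longleftrightarrow> lead_condition"
proof
  assume L: lead_condition
  have "\<exists>t\<in>lbs.span (Irr deg S). f - t \<in> lbs.gen_ideal S" for f
  proof -
    obtain g t where gt: "g \<in> normal_span (\<lambda>_. True)"
      "t \<in> nf_span (\<lambda>w. True \<and> irreducible_word w)" "f = g + t"
      by (rule reduction[of f "\<lambda>_. True"]) (auto simp: nf_span_iff)
    then have "t \<in> lbs.span (Irr deg S)" by (simp add: Irr_eq nf_span_def)
    moreover have "f - t \<in> lbs.gen_ideal S" using gt(1,3) normal_span_gen_ideal by auto
    ultimately show ?thesis by blast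
  qed
  moreover have "t - g \<notin> lbs.gen_ideal S" if t: "t \<in> Irr deg S" and g: "g \<in> lbs.span (Irr deg S - {t})" for t g
  proof
    assume I: "t - g \<in> lbs.gen_ideal S"
    obtain w where w: "w \<noteq> []" "irreducible_word w" "t = nf w" using t by (auto simp: Irr_eq)
    have g': "g \<in> nf_span (\<lambda>v. irreducible_word v \<and> v \<noteq> w)"
      using g w by (simp add: Irr_minus_nf)
    then have "coeff g (nf w) = 0" using w(1) unfolding nf_span_iff by blast
    \<comment> \<open>The coefficient 1 makes \<open>t - g\<close> a nonzero combination of
      irreducible words in the ideal.\<close>
    then have "coeff (t - g) (nf w) = 1" using w by (simp add: coeff_diff coeff_nf)
    moreover have "t - g \<in> nf_span irreducible_word"
      unfolding w(3) by (intro lbs.subspace_diff subspace_nf_span nf_spanI w nf_span_mono[OF g']) blast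
    ultimately show False using irreducible_eq_zero[OF L I] by (simp add: coeff_zero)
  qed
  ultimately show "lbs.basis_of_quot (lbs.gen_ideal S) (Irr deg S)"
    unfolding lbs.basis_of_quot_iff[OF subspace_gen_ideal] by blast
next
  assume "lbs.basis_of_quot (lbs.gen_ideal S) (Irr deg S)"
  then have indep: "t - g \<notin> lbs.gen_ideal S" if "t \<in> Irr deg S" "g \<in> lbs.span (Irr deg S - {t})" for t g
    using that unfolding lbs.basis_of_quot_iff[OF subspace_gen_ideal] by blast
  show lead_condition
    unfolding lead_condition_def
  proof (intro ballI impI)
    fix f assume f: "f \<in> lbs.gen_ideal S" "f \<noteq> 0"
    obtain w where w: "w \<noteq> []" "coeff f (nf w) \<noteq> 0" "lead deg f = nf w"
      "f - lscale (coeff f (nf w)) (nf w) \<in> nf_span (\<lambda>v. word_less deg v w)"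
      using f(2) by (rule ex_lead_word)
    define c where "c = coeff f (nf w)"
    have "\<exists>h. normal h w"
    proof (rule ccontr)
      assume irr: "irreducible_word w"
      \<comment> \<open>Only the part of \<open>f\<close> below its leading word is reduced. Modulo
        the ideal this makes \<open>nf w\<close> a combination of smaller irreducible words,
        contradicting independence if \<open>w\<close> were irreducible.\<close>
      obtain g t where gt: "g \<in> normal_span (\<lambda>v. word_less deg v w)"
        "t \<in> nf_span (\<lambda>v. word_less deg v w \<and> irreducible_word v)"
        "f - lscale c (nf w) = g + t"
        using reduction[OF w(4)[folded c_def]] word_less_trans by blast
      have c: "c \<noteq> 0" using w(2) by (simp add: c_def)
      have "t \<in> nf_span (\<lambda>v. irreducible_word v \<and> v \<noteq> w)"
        using gt(2) by (rule nf_span_mono) auto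
      then have t: "lscale (- inverse c) t \<in> lbs.span (Irr deg S - {nf w})"
        unfolding Irr_minus_nf[OF w(1)] by (rule lbs.subspace_scale[OF subspace_nf_span])
      have "lscale c (nf w) + t = f - g" using gt(3) by (simp add: algebra_simps)
      moreover have "f - g \<in> lbs.gen_ideal S"
        using lbs.subspace_diff[OF subspace_gen_ideal f(1)] gt(1) normal_span_gen_ideal by blast
      ultimately have "lscale (inverse c) (lscale c (nf w) + t) \<in> lbs.gen_ideal S"
        using lbs.subspace_scale[OF subspace_gen_ideal] by metis
      then have "nf w - lscale (- inverse c) t \<in> lbs.gen_ideal S"
        using c by (simp add: lbs.scale_right_distrib)
      moreover have "nf w \<in> Irr deg S" using w(1) irr by (auto simp: Irr_eq)
      ultimately show False using indep t by blast
    qed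
    then show "\<exists>h\<in>normal_polys deg S. lead deg f = lead deg h"
      using w(3) by (metis lead_normal normal_polys_iff)
  qed
qed

end

theorem theorem4p11:
  fixes deg :: "'x::{super_set,wellorder} \<Rightarrow> nat"
    and S :: "('x, 'k::field) lbs set"
  assumes "\<forall>x. deg x > 0"
    and "S \<noteq> {}"
    and "\<forall>s\<in>S. monic deg s"
    and "\<forall>s\<in>S. homogeneous s"
  shows "(gs_basis deg S \<longleftrightarrow>
            (\<forall>f\<in>lbs.gen_ideal S. f \<noteq> 0 \<longrightarrow> (\<exists>h\<in>normal_polys deg S. lead deg f = lead deg h))) \<and>
         ((\<forall>f\<in>lbs.gen_ideal S. f \<noteq> 0 \<longrightarrow> (\<exists>h\<in>normal_polys deg S. lead deg f = lead deg h)) \<longleftrightarrow>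
            lbs.basis_of_quot (lbs.gen_ideal S) (Irr deg S))"
proof -
  interpret monic_homogeneous_set deg S
    by standard (use assms in auto)
  show ?thesis
    using gs_basis_iff basis_of_quot_Irr_iff unfolding lead_condition_def by blast
qed

end
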